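(* Let $B$ be a compact region in $\mathbb{R}^n$ having finite measure, and let $Y$ be any closed subscheme of $\mathbb{A}^n_{\mathbb{Z}}$ of codimension $k\ge1$. Let $r$ and $M$ be positive real numbers. Then $$\#\{a\in rB\cap\mathbb{Z}^n \;:\; a\ (\mathrm{mod}\ p)\in Y(\mathbb{F}_p)\text{ for some prime }p>M\}=O\left(\frac{r^n}{M^{k-1}\log M}+r^{n-k+1}\right),$$ where the implied constant depends only on $B$ and on $Y$.
   Context: $rB=\{rb: b\in B\}$. For a prime $p$, $a\ (\mathrm{mod}\ p)$ denotes the reduction of $a\in\mathbb{Z}^n$ to a point of $\mathbb{F}_p^n=\mathbb{A}^n(\mathbb{F}_p)$, and $Y(\mathbb{F}_p)\subseteq\mathbb{F}_p^n$ is the set of $\mathbb{F}_p$-points of $Y$.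
   Formalization: The bound is proved for r ≥ δ with a constant depending on B, Y and δ (any δ > 0), since it fails as r → 0 when 0 ∈ B and Y contains the origin (k ≤ n); M = 1 is excluded and log M is read as |log M|, since for M ≤ 1 the stated bound is undefined, zero or negative. *)

theory Defs
  imports
    "HOL-Analysis.Analysis"
    "HOL-Algebra.Ideal"
    "HOL-Decision_Procs.Algebra_Aux"
    "HOL-Library.Extended_Nat"
    "HOL-Library.Poly_Mapping"
    "HOL-Number_Theory.Residues"
begin

text \<open>The polynomial ring over the integers in variables indexed by the finite type \<open>'n\<close>:
  a polynomial maps each monomial, given by its exponent vector, to its coefficient. The
  multiplication of \<^type>\<open>poly_mapping\<close> is convolution.\<close>

type_synonym 'n int_mpoly = "('n \<Rightarrow>\<^sub>0 nat) \<Rightarrow>\<^sub>0 int"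

abbreviation int_mpoly_ring :: "'n int_mpoly ring"
  where "int_mpoly_ring \<equiv> cring_class_ops"

definition eval_int_mpoly :: "('n::finite) int_mpoly \<Rightarrow> int ^ 'n \<Rightarrow> int"
  where "eval_int_mpoly f x =
    (\<Sum>m\<in>Poly_Mapping.keys f.
      Poly_Mapping.lookup f m * (\<Prod>i\<in>UNIV. (x $ i) ^ Poly_Mapping.lookup m i))"

definition prime_ideal_height :: "('a, 'b) ring_scheme \<Rightarrow> 'a set \<Rightarrow> enat"
  where "prime_ideal_height R P =
    Sup {enat m | m. \<exists>Q :: nat \<Rightarrow> 'a set.
      (\<forall>i\<le>m. primeideal (Q i) R) \<and> (\<forall>i<m. Q i \<subset> Q (Suc i)) \<and> Q m = P}"

text \<open>The codimension in \<open>Spec R\<close> of the closed subscheme \<open>V(I)\<close>: the infimum of the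
  codimensions of the irreducible closed subsets \<open>V(P)\<close> of \<open>V(I)\<close>, where the codimension of
  \<open>V(P)\<close> is the supremum of the lengths of chains of irreducible closed subsets ascending
  from \<open>V(P)\<close>, that is, of chains of primes descending from \<open>P\<close>. The empty subscheme has
  codimension \<open>\<infinity>\<close>.\<close>

definition codimension :: "('a, 'b) ring_scheme \<Rightarrow> 'a set \<Rightarrow> enat"
  where "codimension R I = (INF P \<in> {P. primeideal P R \<and> I \<subseteq> P}. prime_ideal_height R P)"

text \<open>Points of affine space over the prime field with \<open>p\<close> elements are vectors with
  coordinates in the carrier \<open>{0..p - 1}\<close> of \<^const>\<open>residue_ring\<close>.\<close>

definition Fp_points :: "('n::finite) int_mpoly set \<Rightarrow> nat \<Rightarrow> (int ^ 'n) set"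
  where "Fp_points I p =
    {x. (\<forall>i. x $ i \<in> carrier (residue_ring (int p))) \<and>
        (\<forall>f\<in>I. [eval_int_mpoly f x = 0] (mod int p))}"

definition reduce_mod :: "int ^ 'n \<Rightarrow> nat \<Rightarrow> int ^ ('n::finite)"
  where "reduce_mod a p = (\<chi> i. (a $ i) mod int p)"

definition real_vec :: "int ^ 'n \<Rightarrow> real ^ ('n::finite)"
  where "real_vec a = (\<chi> i. real_of_int (a $ i))"

end

theory Submission
  imports Defs
begin

text \<open>Write \<open>n\<close> for the number of variables and \<open>s = n + 1 - k\<close>, or \<open>s = 0\<close> if this is negative. The
  geometry of \<open>Y\<close> enters only through eliminants: for every set \<open>S\<close> of \<open>s\<close> variables the ideal contains a nonzero polynomial \<open>f\<^sub>S\<close> in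
  the variables of \<open>S\<close> alone (\<open>eliminant_exists\<close>). Otherwise some prime \<open>P \<supseteq> Y\<close> contains no nonzero
  polynomial in the variables of \<open>S\<close>. Picking one element from each gap of a chain of primes
  descending from \<open>P\<close> then gives elements that are algebraically independent over \<open>\<int>[S]\<close>, so that
  the chain has length at most \<open>n - s\<close>, and \<open>n - s < k\<close> contradicts the codimension.

  The counting reads the coordinates of an integer point \<open>a\<close> one after the other. Let \<open>q\<close> be \<open>0\<close> or
  a prime, and suppose that \<open>q\<close> divides every \<open>f\<^sub>S(a)\<close> but no \<open>f\<^sub>S\<close>; large primes
  divide no \<open>f\<^sub>S\<close>. While the coordinates are
  substituted into \<open>f\<^sub>S\<close>, it passes at some coordinate \<open>j \<in> S\<close> from being nonzero modulo \<open>q\<close> to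
  being zero; there \<open>a\<^sub>j\<close> is a root modulo \<open>q\<close> of a nonzero univariate polynomial known from the
  earlier coordinates, hence is confined to boundedly many residue classes. The coordinates at
  which no \<open>f\<^sub>S\<close> makes this transition do not contain any set of size \<open>s\<close>, so at most \<open>s - 1\<close>
  coordinates are free (\<open>card_undetermined_less\<close>), and there are no such points if \<open>s = 0\<close>. This
  one observation gives three bounds for points in the box of radius \<open>R\<close>, where \<open>R\<close> has the size
  of \<open>r\<close>:

  \<^item> For a prime \<open>p \<le> R\<close> there are \<open>O((R / p)\<^sup>n p\<^sup>s\<^sup>-\<^sup>1) = O(R\<^sup>n / p\<^sup>k)\<close> points, and Chebyshev's upper
    bound for the number of primes turns the sum over \<open>p > M\<close> into \<open>O(R\<^sup>n / (M\<^sup>k\<^sup>-\<^sup>1 log M))\<close>.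

  \<^item> Points at which every \<open>f\<^sub>S\<close> vanishes over \<open>\<int>\<close> are the case \<open>q = 0\<close>; there are \<open>O(R\<^sup>s\<^sup>-\<^sup>1)\<close>.

  \<^item> For the remaining points with a prime \<open>p > R\<close> the prime varies with the point. Consider the
    first coordinate after which some partially substituted \<open>f\<^sub>S\<close> is zero modulo \<open>p\<close> but not over
    \<open>\<int>\<close>. Before it, being determined means the same modulo \<open>p\<close> and over \<open>\<int>\<close>, so \<open>p\<close> need not be
    known. Right after it, \<open>p\<close> is a prime factor exceeding \<open>R\<close> of a nonzero integer of size
    \<open>R\<^sup>O\<^sup>(\<^sup>1\<^sup>)\<close>, which leaves \<open>O(1)\<close> choices, and the later coordinates are read modulo the known \<open>p\<close>.
    Only this one coordinate is read freely in addition to the free ones modulo \<open>p\<close>, which gives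
    \<open>O(R\<^sup>s)\<close> points.

  If \<open>k = 1\<close> or \<open>M\<close> is bounded, the claim is weaker than the bound \<open>O(r\<^sup>n)\<close> for all lattice points.\<close>

section \<open>Prime ideals of a commutative ring\<close>

lemma ideal_class_closed:
  fixes P :: "'a::comm_ring_1 set"
  assumes "ideal P cring_class_ops"
  shows "0 \<in> P" "x \<in> P \<Longrightarrow> y \<in> P \<Longrightarrow> x + y \<in> P" "x \<in> P \<Longrightarrow> - x \<in> P" "x \<in> P \<Longrightarrow> r * x \<in> P"
proof -
  interpret ideal P cring_class_ops by (fact assms)
  show "0 \<in> P" using zero_closed by (simp add: zero_class)
  show "x + y \<in> P" if "x \<in> P" "y \<in> P" using a_closed[OF that] by (simp add: plus_class)
  show "r * x \<in> P" if "x \<in> P" for r using I_l_closed[OF that, of r] by (simp add: times_class carrier_class)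
  from this[of "-1"] show "- x \<in> P" if "x \<in> P" using that by simp
qed

lemma ideal_classI:
  fixes P :: "'a::comm_ring_1 set"
  assumes "0 \<in> P" "\<And>x y. x \<in> P \<Longrightarrow> y \<in> P \<Longrightarrow> x + y \<in> P" "\<And>x r. x \<in> P \<Longrightarrow> r * x \<in> P"
  shows "ideal P cring_class_ops"
proof (rule idealI)
  show "ring (cring_class_ops :: 'a ring)"
    using cring_class by (rule cring.axioms(1))
  have minus: "- x \<in> P" if "x \<in> P" for x
    using assms(3)[OF that, of "-1"] by simp
  show "subgroup P (add_monoid cring_class_ops)"
  proof (rule group.subgroupI)
    show "group (add_monoid (cring_class_ops :: 'a ring))"
      using cring_class.is_abelian_group abelian_group.a_group by blast
    show "inv\<^bsub>add_monoid cring_class_ops\<^esub> a \<in> P" if "a \<in> P" for a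
      using minus[OF that] uminus_class[of a] by (simp add: a_inv_def)
  qed (use assms in \<open>auto simp: carrier_class cring_class_ops_def\<close>)
qed (use assms in \<open>auto simp: times_class mult.commute\<close>)

lemma ideal_class_sum:
  fixes P :: "'a::comm_ring_1 set"
  assumes "ideal P cring_class_ops" "\<And>i. i \<in> A \<Longrightarrow> f i \<in> P"
  shows "(\<Sum>i\<in>A. f i) \<in> P"
  using assms(2) by (induction A rule: infinite_finite_induct)
    (auto intro: ideal_class_closed[OF assms(1)])

lemma primeideal_class_mult:
  fixes P :: "'a::comm_ring_1 set"
  assumes "primeideal P cring_class_ops" "x * y \<in> P" "x \<notin> P"
  shows "y \<in> P"
  using primeideal.I_prime[OF assms(1)] assms by (auto simp: times_class carrier_class)

lemma primeideal_class_power: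
  fixes P :: "'a::comm_ring_1 set"
  assumes "primeideal P cring_class_ops" "g ^ i * y \<in> P" "g \<notin> P"
  shows "y \<in> P"
  using assms(2) by (induction i) (auto simp: mult.assoc dest: primeideal_class_mult[OF assms(1) _ assms(3)])

text \<open>An ideal that is maximal among those containing \<open>I\<close> and disjoint from the multiplicative set \<open>W\<close>
  is prime: if neither \<open>a\<close> nor \<open>b\<close> lies in it, then adjoining either of them produces an element of
  \<open>W\<close>, and the product of the two elements would lie in the ideal as soon as \<open>a * b\<close> does.\<close>

lemma exists_prime_avoiding:
  fixes I W :: "'a::comm_ring_1 set"
  assumes "ideal I cring_class_ops" "I \<inter> W = {}" "1 \<in> W" "\<And>x y. x \<in> W \<Longrightarrow> y \<in> W \<Longrightarrow> x * y \<in> W"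
  shows "\<exists>P. primeideal P cring_class_ops \<and> I \<subseteq> P \<and> P \<inter> W = {}"
proof -
  define F where "F = {J. ideal J cring_class_ops \<and> I \<subseteq> J \<and> J \<inter> W = {}}"
  have "\<exists>P\<in>F. \<forall>X\<in>F. P \<subseteq> X \<longrightarrow> X = P"
  proof (rule subset_Zorn_nonempty)
    show "F \<noteq> {}" using assms by (auto simp: F_def)
    fix C assume C: "C \<noteq> {}" "subset.chain F C"
    then have CF: "C \<subseteq> F" and lin: "\<And>X Y. X \<in> C \<Longrightarrow> Y \<in> C \<Longrightarrow> X \<subseteq> Y \<or> Y \<subseteq> X"
      by (auto simp: subset_chain_def)
    have "ideal (\<Union>C) cring_class_ops"
    proof (rule ideal_classI)
      show "0 \<in> \<Union>C" using C(1) CF ideal_class_closed(1) by (fastforce simp: F_def)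
      show "r * x \<in> \<Union>C" if "x \<in> \<Union>C" for x r
        using that CF ideal_class_closed(4) by (fastforce simp: F_def)
      show "x + y \<in> \<Union>C" if xy: "x \<in> \<Union>C" "y \<in> \<Union>C" for x y
      proof -
        obtain X where "X \<in> C" "x \<in> X" "y \<in> X"
          using xy lin by blast
        then show ?thesis
          using CF ideal_class_closed(2)[of X x y] unfolding F_def by blast
      qed
    qed
    then show "\<Union>C \<in> F"
      using C(1) CF by (auto simp: F_def)
  qed
  then obtain P where P: "P \<in> F" and max: "\<And>X. X \<in> F \<Longrightarrow> P \<subseteq> X \<Longrightarrow> X = P"
    by blast
  have id: "ideal P cring_class_ops" and IP: "I \<subseteq> P" and PW: "P \<inter> W = {}"
    using P by (auto simp: F_def)
  have meets: "\<exists>w\<in>W. \<exists>u\<in>P. \<exists>r. w = u + r * a" if "a \<notin> P" for a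
  proof -
    define J where "J = {u + r * a | u r. u \<in> P}"
    have "ideal J cring_class_ops"
    proof (rule ideal_classI)
      show "0 \<in> J" using ideal_class_closed(1)[OF id] unfolding J_def
        by (intro CollectI exI[of _ 0]) simp
      show "x + y \<in> J" if "x \<in> J" "y \<in> J" for x y
      proof -
        from that obtain u r u' r' where "x = u + r * a" "y = u' + r' * a" "u \<in> P" "u' \<in> P"
          by (auto simp: J_def)
        then have "x + y = (u + u') + (r + r') * a" "u + u' \<in> P"
          using ideal_class_closed(2)[OF id] by (auto simp: algebra_simps)
        then show ?thesis unfolding J_def by blast
      qed
      show "s * x \<in> J" if "x \<in> J" for x s
      proof -
        from that obtain u r where "x = u + r * a" "u \<in> P"
          by (auto simp: J_def)
        then have "s * x = s * u + (s * r) * a" "s * u \<in> P"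
          using ideal_class_closed(4)[OF id, of u s] by (simp_all add: algebra_simps)
        then show ?thesis unfolding J_def by blast
      qed
    qed
    moreover have "P \<subseteq> J"
    proof
      fix u assume "u \<in> P"
      then show "u \<in> J" unfolding J_def by (intro CollectI exI[of _ u] exI[of _ 0]) auto
    qed
    moreover have "a \<in> J"
      unfolding J_def using ideal_class_closed(1)[OF id]
      by (intro CollectI exI[of _ 0] exI[of _ 1]) auto
    ultimately have "J \<inter> W \<noteq> {}"
      using max[of J] that IP by (auto simp: F_def)
    then show ?thesis by (auto simp: J_def)
  qed
  have "primeideal P cring_class_ops"
  proof (rule primeidealI[OF id cring_class])
    show "carrier cring_class_ops \<noteq> P"
      using PW assms(3) carrier_class by blast
    fix a b :: 'a
    assume "a \<otimes>\<^bsub>cring_class_ops\<^esub> b \<in> P"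
    then have ab: "a * b \<in> P" by (simp add: times_class)
    show "a \<in> P \<or> b \<in> P"
    proof (rule ccontr)
      assume "\<not> ?thesis"
      then obtain u r v s where "u \<in> P" "v \<in> P" and W: "u + r * a \<in> W" "v + s * b \<in> W"
        using meets[of a] meets[of b] by blast
      have "(u + r * a) * (v + s * b) = (v + s * b) * u + ((r * a) * v + (r * s) * (a * b))"
        by (simp add: algebra_simps)
      also have "\<dots> \<in> P"
        by (intro ideal_class_closed(2,4)[OF id] \<open>u \<in> P\<close> \<open>v \<in> P\<close> ab)
      finally show False
        using assms(4)[OF W] PW by blast
    qed
  qed
  with IP PW show ?thesis by blast
qed


section \<open>Chains of primes and algebraic independence\<close>

definition exponents :: "nat \<Rightarrow> nat \<Rightarrow> nat list set"
  where "exponents N m = {e. set e \<subseteq> {..N} \<and> length e = m}"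

definition monom_at :: "'a::comm_monoid_mult list \<Rightarrow> nat list \<Rightarrow> 'a"
  where "monom_at gs e = prod_list (map2 (^) gs e)"

lemma monom_at_Nil [simp]: "monom_at [] e = 1"
  and monom_at_Cons [simp]: "monom_at (g # gs) (i # e) = g ^ i * monom_at gs e"
  by (simp_all add: monom_at_def)

lemma finite_exponents [simp]: "finite (exponents N m)"
  by (simp add: exponents_def finite_lists_length_eq)

lemma card_exponents: "card (exponents N m) = (N + 1) ^ m"
  by (simp add: exponents_def card_lists_length_eq)

lemma exponents_0 [simp]: "exponents N 0 = {[]}"
  by (auto simp: exponents_def)

lemma sum_exponents_Suc:
  "(\<Sum>e\<in>exponents N (Suc m). f e) = (\<Sum>i\<le>N. \<Sum>e\<in>exponents N m. f (i # e))"
proof -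
  have "exponents N (Suc m) = (\<lambda>(i, e). i # e) ` ({..N} \<times> exponents N m)"
    by (auto simp: exponents_def length_Suc_conv image_iff)
  moreover have "inj_on (\<lambda>(i, e). i # e) ({..N} \<times> exponents N m)"
    by (auto simp: inj_on_def)
  ultimately show ?thesis
    by (simp add: sum.reindex sum.cartesian_product split_def)
qed

text \<open>Elements \<open>g\<^sub>i\<close> of the gaps \<open>Q\<^sub>i\<^sub>+\<^sub>1 - Q\<^sub>i\<close> of a chain of primes satisfy no nontrivial polynomial relation
  with coefficients in \<open>A\<close>, even modulo the bottom of the chain. In a relation, let
  \<open>g\<^sub>0\<^sup>i\<close> be the lowest power of \<open>g\<^sub>0\<close> with a nonzero coefficient. As \<open>Q\<^sub>0\<close> is prime and does not
  contain \<open>g\<^sub>0\<close>, this power can be divided out. Modulo \<open>Q\<^sub>1\<close>, which contains \<open>g\<^sub>0\<close>, only the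
  coefficient of that power remains, and it is a relation of the same kind between the other
  elements for the chain that starts at \<open>Q\<^sub>1\<close>.\<close>

lemma prime_chain_independent:
  fixes gs :: "'a::comm_ring_1 list" and Q :: "nat \<Rightarrow> 'a set"
  assumes "\<And>i. i \<le> length gs \<Longrightarrow> primeideal (Q i) cring_class_ops"
    and "\<And>i. i < length gs \<Longrightarrow> Q i \<subseteq> Q (Suc i)"
    and "\<And>i. i < length gs \<Longrightarrow> gs ! i \<in> Q (Suc i) - Q i"
    and "A \<inter> Q (length gs) \<subseteq> {0}"
    and "\<And>e. c e \<in> A"
    and "(\<Sum>e\<in>exponents N (length gs). c e * monom_at gs e) \<in> Q 0"
    and "e \<in> exponents N (length gs)"
  shows "c e = 0"
  using assms
proof (induction gs arbitrary: Q c e)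
  case Nil
  then show ?case by auto
next
  case (Cons g gs)
  define G where "G i = (\<Sum>e\<in>exponents N (length gs). c (i # e) * monom_at gs e)" for i
  have prime0: "primeideal (Q 0) cring_class_ops" and prime1: "primeideal (Q 1) cring_class_ops"
    using Cons.prems(1)[of 0] Cons.prems(1)[of 1] by auto
  have id0: "ideal (Q 0) cring_class_ops" and id1: "ideal (Q 1) cring_class_ops"
    using prime0 prime1 primeideal.axioms(1) by blast+
  have g: "g \<in> Q 1" "g \<notin> Q 0" and sub: "Q 0 \<subseteq> Q 1"
    using Cons.prems(3)[of 0] Cons.prems(2)[of 0] by auto
  have sumG: "(\<Sum>i\<le>N. g ^ i * G i) \<in> Q 0"
    using Cons.prems(6)
    by (simp add: sum_exponents_Suc G_def sum_distrib_left mult_ac)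
  have vanish: "\<forall>e\<in>exponents N (length gs). c (i # e) = 0" if "i \<le> N" for i
    using that
  proof (induction i rule: less_induct)
    case (less i)
    have "G j = 0" if "j < i" for j
      using less.IH[OF that] less.prems that by (auto simp: G_def intro!: sum.neutral)
    then have "(\<Sum>j\<le>N. g ^ j * G j) = (\<Sum>j\<in>{i..N}. g ^ j * G j)"
      by (intro sum.mono_neutral_right) auto
    also have "\<dots> = g ^ i * G i + (\<Sum>j\<in>{Suc i..N}. g ^ j * G j)"
      using less.prems by (simp add: sum.atLeast_Suc_atMost)
    also have "(\<Sum>j\<in>{Suc i..N}. g ^ j * G j) = g ^ i * (\<Sum>j\<in>{Suc i..N}. g ^ (j - i) * G j)"
      unfolding sum_distrib_left
      by (intro sum.cong refl) (auto simp: mult.assoc[symmetric] power_add[symmetric])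
    \<comment> \<open>The powers below \<open>i\<close> have disappeared, so the sum is divisible by \<open>g ^ i\<close>.\<close>
    finally have "g ^ i * (G i + (\<Sum>j\<in>{Suc i..N}. g ^ (j - i) * G j)) \<in> Q 0"
      using sumG by (simp add: distrib_left)
    then have "G i + (\<Sum>j\<in>{Suc i..N}. g ^ (j - i) * G j) \<in> Q 1"
      using primeideal_class_power[OF prime0 _ g(2)] sub by blast
    moreover have "(\<Sum>j\<in>{Suc i..N}. g ^ (j - i) * G j) \<in> Q 1"
    proof (rule ideal_class_sum[OF id1])
      fix j assume "j \<in> {Suc i..N}"
      then have "g ^ (j - i) * G j = (g ^ (j - i - 1) * G j) * g"
        by (simp add: mult_ac power_eq_if)
      then show "g ^ (j - i) * G j \<in> Q 1"
        using ideal_class_closed(4)[OF id1 g(1)] by metis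
    qed
    ultimately have Gi: "G i \<in> Q 1"
      using ideal_class_closed(2,3)[OF id1] by (metis add_diff_cancel_right' diff_conv_add_uminus)
    show ?case
    proof
      fix e assume e: "e \<in> exponents N (length gs)"
      show "c (i # e) = 0"
      proof (rule Cons.IH[of "\<lambda>i. Q (Suc i)" "\<lambda>e. c (i # e)" e])
        show "gs ! j \<in> Q (Suc (Suc j)) - Q (Suc j)" if "j < length gs" for j
          using Cons.prems(3)[of "Suc j"] that by simp
      qed (use Cons.prems Gi e in \<open>auto simp: G_def\<close>)
    qed
  qed
  from Cons.prems(7) obtain i e' where "e = i # e'" "i \<le> N" "e' \<in> exponents N (length gs)"
    by (auto simp: exponents_def length_Suc_conv)
  then show ?case using vanish by blast
qed

text \<open>Gaussian elimination without division: the equation \<open>b\<close> is used to eliminate the unknown \<open>z\<close> from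
  the others. Scaling the other unknowns by the pivot keeps the recovered value of \<open>z\<close> integral.\<close>

section \<open>Algebraic dependence of polynomials\<close>

lemma homogeneous_system_nontrivial_solution:
  fixes L :: "'a \<Rightarrow> 'b \<Rightarrow> int"
  assumes "finite A" "finite B" "card B < card A"
  shows "\<exists>d. (\<exists>a\<in>A. d a \<noteq> 0) \<and> (\<forall>b\<in>B. (\<Sum>a\<in>A. d a * L a b) = 0)"
  using assms(2,1,3)
proof (induction B arbitrary: A L rule: finite_induct)
  case empty
  then obtain a where "a \<in> A" by fastforce
  then show ?case by (intro exI[of _ "\<lambda>_. 1"]) auto
next
  case (insert b B)
  show ?case
  proof (cases "\<forall>a\<in>A. L a b = 0")
    case True
    from insert.IH[of A L] insert.prems insert.hyps
    obtain d where "\<exists>a\<in>A. d a \<noteq> 0" "\<forall>b\<in>B. (\<Sum>a\<in>A. d a * L a b) = 0"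
      by auto
    with True show ?thesis by (intro exI[of _ d]) auto
  next
    case False
    then obtain z where z: "z \<in> A" "L z b \<noteq> 0" by blast
    define L' where "L' a b' = L z b * L a b' - L a b * L z b'" for a b'
    have "card B < card (A - {z})"
      using insert.prems insert.hyps z by (simp add: less_diff_conv)
    with insert.IH[of "A - {z}" L'] insert.prems
    obtain d where d: "\<exists>a\<in>A - {z}. d a \<noteq> 0" "\<forall>b\<in>B. (\<Sum>a\<in>A-{z}. d a * L' a b) = 0"
      by auto
    define d' where "d' a = (if a = z then - (\<Sum>a\<in>A-{z}. d a * L a b) else L z b * d a)" for a
    have eq: "(\<Sum>a\<in>A. d' a * L a b') = (\<Sum>a\<in>A-{z}. d a * L' a b')" for b'
    proof -
      have "(\<Sum>a\<in>A. d' a * L a b') = d' z * L z b' + (\<Sum>a\<in>A-{z}. d' a * L a b')"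
        using z insert.prems by (simp add: sum.remove)
      also have "(\<Sum>a\<in>A-{z}. d' a * L a b') = (\<Sum>a\<in>A-{z}. L z b * d a * L a b')"
        by (intro sum.cong) (auto simp: d'_def)
      also have "d' z * L z b' = (\<Sum>a\<in>A-{z}. - (d a * L a b * L z b'))"
        by (simp add: d'_def sum_distrib_right sum_negf)
      finally show ?thesis
        unfolding sum.distrib[symmetric] by (simp add: L'_def algebra_simps)
    qed
    have "(\<Sum>a\<in>A. d' a * L a b) = 0"
      unfolding eq by (simp add: L'_def)
    moreover have "\<exists>a\<in>A. d' a \<noteq> 0"
      using d(1) z by (auto simp: d'_def)
    ultimately show ?thesis
      using d(2) eq by (intro exI[of _ d']) auto
  qed
qed

definition monomials_in :: "'n set \<Rightarrow> nat \<Rightarrow> ('n::finite \<Rightarrow>\<^sub>0 nat) set"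
  where "monomials_in S N =
    {m. Poly_Mapping.keys m \<subseteq> S \<and> (\<forall>i. Poly_Mapping.lookup m i \<le> N)}"

lemma card_monomials_in:
  shows "finite (monomials_in S N)" "card (monomials_in S N) = (N + 1) ^ card S"
proof -
  have bij: "bij_betw (\<lambda>m. restrict (Poly_Mapping.lookup m) S) (monomials_in S N) (S \<rightarrow>\<^sub>E {..N})"
  proof (rule bij_betwI)
    define mk :: "('a \<Rightarrow> nat) \<Rightarrow> ('a \<Rightarrow>\<^sub>0 nat)" where
      "mk h = Abs_poly_mapping (\<lambda>i. if i \<in> S then h i else 0)" for h
    have mk: "Poly_Mapping.lookup (mk h) = (\<lambda>i. if i \<in> S then h i else 0)" for h
      unfolding mk_def by (rule lookup_Abs_poly_mapping) simp
    show "mk \<in> (S \<rightarrow>\<^sub>E {..N}) \<rightarrow> monomials_in S N"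
      by (auto simp: monomials_in_def mk in_keys_iff split: if_splits dest: PiE_mem)
    show "mk (restrict (Poly_Mapping.lookup m) S) = m" if "m \<in> monomials_in S N" for m
      using that by (intro poly_mapping_eqI) (auto simp: mk monomials_in_def in_keys_iff)
    show "restrict (Poly_Mapping.lookup (mk h)) S = h" if "h \<in> S \<rightarrow>\<^sub>E {..N}" for h
      using that by (auto simp: mk fun_eq_iff restrict_def PiE_def extensional_def)
  qed (auto simp: monomials_in_def)
  show "finite (monomials_in S N)"
    unfolding bij_betw_finite[OF bij] by (intro finite_PiE) auto
  show "card (monomials_in S N) = (N + 1) ^ card S"
    unfolding bij_betw_same_card[OF bij] by (subst card_PiE) auto
qed

text \<open>A bound on the degree in each variable separately, which suits counting monomials in a cube.\<close>

definition degrees_le :: "nat \<Rightarrow> ('n::finite) int_mpoly \<Rightarrow> bool"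
  where "degrees_le D f \<longleftrightarrow> Poly_Mapping.keys f \<subseteq> monomials_in UNIV D"

lemma degrees_le_iff:
  "degrees_le D f \<longleftrightarrow> (\<forall>m\<in>Poly_Mapping.keys f. \<forall>i. Poly_Mapping.lookup m i \<le> D)"
  by (auto simp: degrees_le_def monomials_in_def)

lemma degrees_le_mono: "degrees_le D f \<Longrightarrow> D \<le> D' \<Longrightarrow> degrees_le D' f"
  unfolding degrees_le_iff using order_trans by blast

lemma degrees_le_mult:
  assumes "degrees_le D f" "degrees_le E g"
  shows "degrees_le (D + E) (f * g)"
proof -
  have "Poly_Mapping.lookup m i \<le> D + E" if m: "m \<in> Poly_Mapping.keys (f * g)" for m i
  proof -
    obtain a b where "m = a + b" "a \<in> Poly_Mapping.keys f" "b \<in> Poly_Mapping.keys g"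
      using keys_mult[of f g] m by blast
    then show ?thesis
      using assms by (auto simp: degrees_le_iff lookup_add intro!: add_mono)
  qed
  then show ?thesis by (auto simp: degrees_le_iff)
qed

lemma degrees_le_one: "degrees_le D 1"
  by (auto simp: degrees_le_iff)

lemma degrees_le_power: "degrees_le D f \<Longrightarrow> degrees_le (i * D) (f ^ i)"
  by (induction i) (auto simp: degrees_le_one intro: degrees_le_mult)

lemma degrees_le_exists: "\<exists>D. degrees_le D (f :: ('n::finite) int_mpoly)"
proof -
  have "finite ((\<lambda>(m, i). Poly_Mapping.lookup m i) ` (Poly_Mapping.keys f \<times> UNIV))"
    by simp
  then obtain D where "\<forall>x\<in>(\<lambda>(m, i). Poly_Mapping.lookup m i) ` (Poly_Mapping.keys f \<times> UNIV). x \<le> D"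
    using finite_nat_set_iff_bounded_le by blast
  then show ?thesis by (auto simp: degrees_le_iff)
qed

lemma degrees_le_exists_list:
  "\<exists>D. \<forall>f\<in>set fs. degrees_le D (f :: ('n::finite) int_mpoly)"
proof (induction fs)
  case (Cons f fs)
  then obtain D where D: "\<forall>f\<in>set fs. degrees_le D f" by blast
  obtain E where "degrees_le E f" using degrees_le_exists by blast
  with D have "\<forall>g\<in>set (f # fs). degrees_le (D + E) g"
    by (auto intro: degrees_le_mono)
  then show ?case by blast
qed simp

lemma degrees_le_monom_at:
  assumes "\<forall>g\<in>set gs. degrees_le D g" "e \<in> exponents N (length gs)"
  shows "degrees_le (length gs * (N * D)) (monom_at gs e)"
  using assms
proof (induction gs arbitrary: e)
  case Nil
  then show ?case by (simp add: degrees_le_one)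
next
  case (Cons g gs)
  then obtain i e' where e: "e = i # e'" "i \<le> N" "e' \<in> exponents N (length gs)"
    by (auto simp: exponents_def length_Suc_conv)
  have "degrees_le (N * D) (g ^ i)"
    using degrees_le_power[of D g i] Cons.prems e by (auto elim: degrees_le_mono)
  with Cons.IH[of e'] Cons.prems e show ?case
    by (auto intro: degrees_le_mult)
qed

lemma lookup_single_mult:
  fixes f :: "'n::finite int_mpoly"
  shows "Poly_Mapping.lookup (Poly_Mapping.single u d * f) v =
    d * Poly_Mapping.lookup (Poly_Mapping.single u 1 * f) v"
proof -
  have "Poly_Mapping.single u d = frag_cmul d (Poly_Mapping.single u 1)"
    by (rule poly_mapping_eqI) (simp add: lookup_single when_def)
  moreover have "frag_cmul d x * f = frag_cmul d (x * f)" for x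
  proof -
    have *: "frag_cmul d y = Poly_Mapping.single 0 d * y" for y :: "'n int_mpoly"
      unfolding mult_map_scale_conv_mult[symmetric]
      by (rule poly_mapping_eqI) (simp add: Poly_Mapping.map.rep_eq when_def)
    show ?thesis unfolding * by (simp add: mult.assoc)
  qed
  ultimately show ?thesis by simp
qed

text \<open>The products of a monomial in \<open>S\<close> with powers of the \<open>g\<^sub>i\<close>, all exponents at most \<open>N\<close>, number
  \<open>(N + 1)\<close> to the power \<open>length gs + card S > n\<close>, whereas they involve only monomials of degree \<open>O(N)\<close> in
  each variable, of which there are \<open>O(N\<^sup>n)\<close>. For large \<open>N\<close> there are more products than monomials,
  hence a linear relation over \<open>\<int>\<close>; collecting the monomials in \<open>S\<close> gives the coefficients \<open>c e\<close>.\<close>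

lemma algebraic_dependence:
  fixes gs :: "('n::finite) int_mpoly list"
  assumes "CARD('n) < length gs + card S"
  shows "\<exists>N c. (\<forall>e. Poly_Mapping.keys (c e) \<subseteq> {m. Poly_Mapping.keys m \<subseteq> S}) \<and>
    (\<exists>e\<in>exponents N (length gs). c e \<noteq> 0) \<and>
    (\<Sum>e\<in>exponents N (length gs). c e * monom_at gs e) = 0"
proof -
  define n where "n = CARD('n)"
  obtain D where D: "\<forall>g\<in>set gs. degrees_le D g"
    using degrees_le_exists_list by blast
  define E where "E = 1 + length gs * D"
  \<comment> \<open>Chosen so that \<open>(E * N + 1)\<^sup>n \<le> E\<^sup>n * (N + 1)\<^sup>n < (N + 1)\<^sup>n\<^sup>+\<^sup>1\<close>.\<close>
  define N where "N = E ^ n"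
  define A where "A = exponents N (length gs) \<times> monomials_in S N"
  define V where "V = (monomials_in UNIV (E * N) :: ('n \<Rightarrow>\<^sub>0 nat) set)"
  define L where "L = (\<lambda>(e, u) v. Poly_Mapping.lookup (Poly_Mapping.single u 1 * monom_at gs e) v)"
  have "card V = (E * N + 1) ^ n"
    by (simp add: V_def card_monomials_in n_def)
  also have "\<dots> \<le> (E * (N + 1)) ^ n"
    by (intro power_mono) (auto simp: E_def)
  also have "\<dots> = N * (N + 1) ^ n"
    unfolding power_mult_distrib N_def ..
  also have "\<dots> < (N + 1) ^ (n + 1)"
    by simp
  also have "\<dots> \<le> (N + 1) ^ (length gs + card S)"
    using assms by (intro power_increasing) (auto simp: n_def)
  also have "\<dots> = card A"
    by (simp add: A_def card_cartesian_product card_exponents card_monomials_in power_add)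
  finally have "card V < card A" .
  moreover have "finite V" "finite A"
    by (simp_all add: V_def A_def card_monomials_in)
  ultimately obtain d where d: "\<exists>a\<in>A. d a \<noteq> 0" "\<forall>v\<in>V. (\<Sum>a\<in>A. d a * L a v) = 0"
    using homogeneous_system_nontrivial_solution[of A V L] by blast
  define c where "c e = (\<Sum>u\<in>monomials_in S N. Poly_Mapping.single u (d (e, u)))" for e
  have lookup_c: "Poly_Mapping.lookup (c e) u = (if u \<in> monomials_in S N then d (e, u) else 0)" for e u
    by (auto simp: c_def lookup_sum lookup_single when_def sum.delta' card_monomials_in sum.delta)
  have "Poly_Mapping.lookup (\<Sum>e\<in>exponents N (length gs). c e * monom_at gs e) v = 0" for v
  proof -
    have eq: "Poly_Mapping.lookup (\<Sum>e\<in>exponents N (length gs). c e * monom_at gs e) v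
      = (\<Sum>a\<in>A. d a * L a v)"
      unfolding c_def A_def L_def sum_distrib_right lookup_sum sum.cartesian_product split_def
      by (intro sum.cong refl, subst lookup_single_mult) simp
    show ?thesis
    proof (cases "v \<in> V")
      case True
      then show ?thesis using d(2) eq by simp
    next
      case False
      have "L a v = 0" if aA: "a \<in> A" for a
      proof -
        obtain e u where a: "a = (e, u)" "e \<in> exponents N (length gs)" "u \<in> monomials_in S N"
          using aA by (auto simp: A_def)
        have "degrees_le N (Poly_Mapping.single u 1)"
          using a(3) by (auto simp: degrees_le_iff monomials_in_def)
        from degrees_le_mult[OF this degrees_le_monom_at[OF D a(2)]]
        have "degrees_le (E * N) (Poly_Mapping.single u 1 * monom_at gs e)"
          by (simp add: E_def algebra_simps)
        with False show ?thesis
          by (auto simp: a L_def degrees_le_def V_def in_keys_iff)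
      qed
      then show ?thesis using eq by simp
    qed
  qed
  then have "(\<Sum>e\<in>exponents N (length gs). c e * monom_at gs e) = 0"
    by (intro poly_mapping_eqI) simp
  moreover have "\<exists>e\<in>exponents N (length gs). c e \<noteq> 0"
  proof -
    from d(1) obtain e u where "(e, u) \<in> A" "d (e, u) \<noteq> 0" by auto
    then show ?thesis
      using lookup_c[of e u] by (intro bexI[of _ e]) (auto simp: A_def)
  qed
  moreover have "Poly_Mapping.keys (c e) \<subseteq> {m. Poly_Mapping.keys m \<subseteq> S}" for e
    by (auto simp: in_keys_iff[of _ "c e"] lookup_c monomials_in_def split: if_splits)
  ultimately show ?thesis by blast
qed

text \<open>One element from each gap of a chain of primes below \<open>P\<close>, together with the variables in \<open>S\<close>, would
  be too many elements for the polynomial ring if the chain were longer.\<close>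

lemma prime_ideal_height_le:
  fixes P :: "('n::finite) int_mpoly set"
  assumes "P \<inter> {f. Poly_Mapping.keys f \<subseteq> {m. Poly_Mapping.keys m \<subseteq> S}} \<subseteq> {0}"
  shows "prime_ideal_height int_mpoly_ring P \<le> enat (CARD('n) - card S)"
  unfolding prime_ideal_height_def
proof (rule Sup_least, clarify)
  fix m and Q :: "nat \<Rightarrow> 'n int_mpoly set"
  assume prime: "\<forall>i\<le>m. primeideal (Q i) int_mpoly_ring" and chain: "\<forall>i<m. Q i \<subset> Q (Suc i)"
    and P: "P = Q m"
  have "\<forall>i. \<exists>g. i < m \<longrightarrow> g \<in> Q (Suc i) - Q i"
    using chain by blast
  then obtain g where g: "\<And>i. i < m \<Longrightarrow> g i \<in> Q (Suc i) - Q i"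
    by metis
  define gs where "gs = map g [0..<m]"
  have "m + card S \<le> CARD('n)"
  proof (rule ccontr)
    assume "\<not> ?thesis"
    then have "CARD('n) < length gs + card S"
      by (simp add: gs_def)
    then obtain N c where c: "\<And>e. Poly_Mapping.keys (c e) \<subseteq> {m. Poly_Mapping.keys m \<subseteq> S}"
        "\<exists>e\<in>exponents N (length gs). c e \<noteq> 0"
        "(\<Sum>e\<in>exponents N (length gs). c e * monom_at gs e) = 0"
      using algebraic_dependence[of gs S] by blast
    have "c e = 0" if "e \<in> exponents N (length gs)" for e
    proof (rule prime_chain_independent[where Q = Q and gs = gs and c = c and N = N and e = e
          and A = "{f. Poly_Mapping.keys f \<subseteq> {m. Poly_Mapping.keys m \<subseteq> S}}"])
      show "(\<Sum>e\<in>exponents N (length gs). c e * monom_at gs e) \<in> Q 0"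
        unfolding c(3) using prime primeideal.axioms(1) ideal_class_closed(1) by blast
    qed (use prime chain g c P assms that in \<open>auto simp: gs_def\<close>)
    with c(2) show False by blast
  qed
  then show "enat m \<le> enat (CARD('n) - card S)"
    by simp
qed

section \<open>Eliminants of a closed subscheme\<close>

text \<open>The index type \<open>'n\<close> carries no linear order, so the polynomial ring is mapped
  injectively into the one with variables indexed by the natural numbers, where leading monomials
  show that there are no zero divisors.\<close>

lemma int_mpoly_no_zero_divisors:
  fixes f g :: "('n::finite) int_mpoly"
  assumes "f \<noteq> 0" "g \<noteq> 0"
  shows "f * g \<noteq> 0"
proof -
  obtain \<iota> :: "'n \<Rightarrow> nat" where \<iota>: "inj \<iota>"
    using finite_imp_inj_to_nat_seg[of "UNIV :: 'n set"] by auto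
  define \<phi> :: "('n \<Rightarrow>\<^sub>0 nat) \<Rightarrow> (nat \<Rightarrow>\<^sub>0 nat)" where
    "\<phi> m = (\<Sum>i\<in>UNIV. Poly_Mapping.single (\<iota> i) (Poly_Mapping.lookup m i))" for m
  have lookup_\<phi>: "Poly_Mapping.lookup (\<phi> m) (\<iota> i) = Poly_Mapping.lookup m i" for m i
  proof -
    have "Poly_Mapping.lookup (\<phi> m) (\<iota> i) = (\<Sum>j\<in>UNIV. if j = i then Poly_Mapping.lookup m j else 0)"
      unfolding \<phi>_def lookup_sum lookup_single
      using \<iota> by (intro sum.cong) (auto simp: when_def dest: injD)
    then show ?thesis by simp
  qed
  have \<phi>_add: "\<phi> (a + b) = \<phi> a + \<phi> b" for a b
    by (simp add: \<phi>_def lookup_add single_add sum.distrib)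
  have \<phi>_inj: "\<phi> a = \<phi> b \<longleftrightarrow> a = b" for a b
    using lookup_\<phi> by (metis poly_mapping_eqI)
  define \<Phi> where "\<Phi> = frag_extend (\<lambda>m. frag_of (\<phi> m))"
  have \<Phi>_mult_of: "\<Phi> (x * frag_of b) = \<Phi> x * \<Phi> (frag_of b)" for x b
  proof (induction x rule: frag_induction[where S = UNIV, OF subset_UNIV])
    case (2 a)
    then show ?case by (simp add: \<Phi>_def mult_single \<phi>_add)
  qed (simp_all add: \<Phi>_def frag_extend_diff left_diff_distrib)
  have \<Phi>_mult: "\<Phi> (x * y) = \<Phi> x * \<Phi> y" for x y
  proof (induction y rule: frag_induction[where S = UNIV, OF subset_UNIV])
    case (2 b)
    show ?case by (rule \<Phi>_mult_of)
  qed (simp_all add: \<Phi>_def frag_extend_diff right_diff_distrib)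
  have \<Phi>_nonzero: "\<Phi> x \<noteq> 0" if "x \<noteq> 0" for x
  proof -
    from that obtain m where m: "Poly_Mapping.lookup x m \<noteq> 0"
      by (metis lookup_zero poly_mapping_eqI)
    have "Poly_Mapping.lookup (\<Phi> x) (\<phi> m) =
        (\<Sum>a\<in>Poly_Mapping.keys x. if a = m then Poly_Mapping.lookup x a else 0)"
      unfolding \<Phi>_def frag_extend_def lookup_sum
      by (intro sum.cong) (auto simp: lookup_single when_def \<phi>_inj)
    also have "\<dots> = Poly_Mapping.lookup x m"
      using m by (simp add: in_keys_iff)
    finally show ?thesis using m by auto
  qed
  have "\<Phi> f * \<Phi> g \<noteq> 0"
    using \<Phi>_nonzero assms by simp
  then show ?thesis
    unfolding \<Phi>_mult[symmetric] by (auto simp: \<Phi>_def)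
qed

text \<open>In geometric terms: the projection of the generic fibre of \<open>Y\<close>, whose dimension is at most
  \<open>n - k\<close>, to any \<open>n + 1 - k\<close> coordinates is not dominant. If \<open>k \<ge> n + 1\<close>, the subtraction gives \<open>0\<close>,
  and the eliminant is a nonzero constant in \<open>Y\<close>.\<close>

lemma eliminant_exists:
  fixes Y :: "('n::finite) int_mpoly set" and k :: nat
  assumes "ideal Y int_mpoly_ring" "codimension int_mpoly_ring Y = enat k" "k \<ge> 1"
    and S: "card S = CARD('n) + 1 - k"
  shows "\<exists>f\<in>Y. f \<noteq> 0 \<and> (\<forall>m\<in>Poly_Mapping.keys f. Poly_Mapping.keys m \<subseteq> S)"
proof (rule ccontr)
  define A where "A = {f :: 'n int_mpoly. Poly_Mapping.keys f \<subseteq> {m. Poly_Mapping.keys m \<subseteq> S}}"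
  assume "\<not> ?thesis"
  then have YA: "Y \<inter> (A - {0}) = {}"
    by (auto simp: A_def)
  have A_mult: "x * y \<in> A - {0}" if xy: "x \<in> A - {0}" "y \<in> A - {0}" for x y
  proof -
    have "Poly_Mapping.keys m \<subseteq> S" if m: "m \<in> Poly_Mapping.keys (x * y)" for m
    proof -
      obtain a b where "m = a + b" "a \<in> Poly_Mapping.keys x" "b \<in> Poly_Mapping.keys y"
        using keys_mult[of x y] m by blast
      then show ?thesis
        using xy keys_add[of a b] by (force simp: A_def)
    qed
    then show ?thesis
      using xy int_mpoly_no_zero_divisors[of x y] by (auto simp: A_def)
  qed
  obtain P where P: "primeideal P int_mpoly_ring" "Y \<subseteq> P" "P \<inter> (A - {0}) = {}"
    using exists_prime_avoiding[OF assms(1) YA _ A_mult] by (auto simp: A_def)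
  have "enat k \<le> prime_ideal_height int_mpoly_ring P"
    using P(1,2) unfolding assms(2)[symmetric] codimension_def by (intro INF_lower) simp
  also have "\<dots> \<le> enat (CARD('n) - card S)"
    using P(3) by (intro prime_ideal_height_le) (auto simp: A_def)
  finally show False
    using S assms(3) by simp
qed

section \<open>Integers in a box\<close>

definition int_box :: "real \<Rightarrow> int set"
  where "int_box R = {x. \<bar>real_of_int x\<bar> \<le> R}"

lemma card_int_interval_le:
  fixes a b :: real
  assumes "a \<le> b + 1"
  shows "finite {k::int. a \<le> k \<and> k \<le> b}" "real (card {k::int. a \<le> k \<and> k \<le> b}) \<le> b - a + 1"
proof -
  have eq: "{k::int. a \<le> k \<and> k \<le> b} = {\<lceil>a\<rceil>..\<lfloor>b\<rfloor>}"
    by (auto simp: le_floor_iff ceiling_le_iff)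
  show "finite {k::int. a \<le> k \<and> k \<le> b}"
    by (simp add: eq)
  have "real (card {\<lceil>a\<rceil>..\<lfloor>b\<rfloor>}) = real_of_int (max 0 (\<lfloor>b\<rfloor> - \<lceil>a\<rceil> + 1))"
    by simp
  also have "\<dots> \<le> b - a + 1"
    using assms of_int_floor_le[of b] le_of_int_ceiling[of a] by (simp add: max_def) linarith
  finally show "real (card {k::int. a \<le> k \<and> k \<le> b}) \<le> b - a + 1"
    by (simp only: eq)
qed

lemma finite_int_box [simp]: "finite (int_box R)"
proof (rule finite_subset)
  show "int_box R \<subseteq> {- \<lfloor>\<bar>R\<bar>\<rfloor>..\<lfloor>\<bar>R\<bar>\<rfloor>}"
    by (auto simp: int_box_def le_floor_iff) linarith+
qed simp

lemma card_residue_class_in_box: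
  assumes "R \<ge> 0"
  shows "real (card {x \<in> int_box R. int q dvd x - z}) \<le> 2 * R / real q + 1"
proof (cases "q = 0")
  case True
  then have "{x \<in> int_box R. int q dvd x - z} \<subseteq> {z}" by auto
  then have "card {x \<in> int_box R. int q dvd x - z} \<le> card {z}"
    by (intro card_mono) auto
  with True show ?thesis by simp
next
  case False
  define K where "K = {k::int. (- R - z) / q \<le> k \<and> k \<le> (R - z) / q}"
  have K: "finite K" "real (card K) \<le> 2 * R / q + 1"
    using card_int_interval_le[of "(- R - z) / q" "(R - z) / q"] assms False
    by (simp_all add: K_def field_simps)
  have "{x \<in> int_box R. int q dvd x - z} \<subseteq> (\<lambda>k. z + int q * k) ` K"
  proof clarify
    fix x assume x: "x \<in> int_box R" "int q dvd x - z"
    then obtain k where k: "x = z + int q * k" by (metis dvdE add_diff_cancel_left' add.commute diff_add_cancel)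
    have "\<bar>real_of_int z + q * real_of_int k\<bar> \<le> R"
      using x(1) by (simp add: int_box_def k)
    then have "k \<in> K"
      using False by (auto simp: K_def field_simps)
    then show "x \<in> (\<lambda>k. z + int q * k) ` K" using k by blast
  qed
  then have "card {x \<in> int_box R. int q dvd x - z} \<le> card K"
    using K(1) by (meson card_image_le card_mono finite_imageI le_trans)
  with K(2) show ?thesis by linarith
qed

lemma card_int_box: "R \<ge> 0 \<Longrightarrow> real (card (int_box R)) \<le> 2 * R + 1"
  using card_residue_class_in_box[of R 1 0] by simp

text \<open>The modulus \<open>0\<close> stands for the integers themselves, since divisibility by \<open>0\<close> is equality with
  \<open>0\<close>. Modulo \<open>0\<close> or a prime a product vanishes only if a factor does, so splitting off one root
  after the other bounds the number of root classes by the degree.\<close>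

lemma poly_roots_mod:
  fixes f :: "int poly"
  assumes "q = 0 \<or> prime q" "Polynomial.degree f \<le> D" "\<not> [:int q:] dvd f"
  shows "\<exists>Z. finite Z \<and> card Z \<le> D \<and> (\<forall>x. int q dvd poly f x \<longrightarrow> (\<exists>z\<in>Z. int q dvd x - z))"
  using assms(2,3)
proof (induction D arbitrary: f)
  case 0
  then obtain a where "f = [:a:]" by (auto elim: degree_eq_zeroE)
  with 0 show ?case by (intro exI[of _ "{}"]) auto
next
  case (Suc D)
  show ?case
  proof (cases "\<exists>r. int q dvd poly f r")
    case False
    then show ?thesis by (intro exI[of _ "{}"]) auto
  next
    case True
    then obtain r where r: "int q dvd poly f r" by blast
    define g where "g = synthetic_div f r"
    have f: "f = [:-r, 1:] * g + [:poly f r:]"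
      unfolding g_def by (rule synthetic_div_correct'[symmetric])
    have "\<not> [:int q:] dvd g"
    proof
      assume "[:int q:] dvd g"
      then have "[:int q:] dvd [:-r, 1:] * g + [:poly f r:]"
        using r by (intro dvd_add dvd_mult) auto
      with f Suc.prems(2) show False by simp
    qed
    moreover have "Polynomial.degree g \<le> D"
      using Suc.prems(1) by (simp add: g_def degree_synthetic_div)
    ultimately obtain Z where Z: "finite Z" "card Z \<le> D"
        "\<And>x. int q dvd poly g x \<Longrightarrow> \<exists>z\<in>Z. int q dvd x - z"
      using Suc.IH by blast
    have "\<exists>z\<in>insert r Z. int q dvd x - z" if x: "int q dvd poly f x" for x
    proof -
      have "poly f x = (x - r) * poly g x + poly f r"
        by (subst f) (simp add: algebra_simps)
      then have "int q dvd (x - r) * poly g x"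
        using x r by (metis add_diff_cancel_right' dvd_diff)
      then have "int q dvd x - r \<or> int q dvd poly g x"
        using assms(1) by (auto simp: prime_dvd_mult_iff)
      with Z(3) show ?thesis by auto
    qed
    then show ?thesis
      using Z(1,2) by (intro exI[of _ "insert r Z"]) (auto simp: card_insert_if)
  qed
qed

text \<open>For \<open>q = 0\<close> the quotient \<open>2 * R / q\<close> is \<open>0\<close>, so the bound is then the number \<open>D\<close> of integer roots.\<close>

lemma card_roots_mod_in_box:
  fixes c :: "nat \<Rightarrow> int"
  assumes "q = 0 \<or> prime q" "R \<ge> 0" "i \<le> D" "\<not> int q dvd c i"
  shows "real (card {x \<in> int_box R. int q dvd (\<Sum>e\<le>D. c e * x ^ e)}) \<le> D * (2 * R / q + 1)"
proof -
  define f where "f = (\<Sum>e\<le>D. Polynomial.monom (c e) e)"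
  have "Polynomial.degree f \<le> D"
    unfolding f_def by (intro degree_sum_le) (auto intro: order_trans[OF degree_monom_le])
  moreover have "poly.coeff f i = c i"
    using assms(3) by (simp add: f_def coeff_sum)
  then have "\<not> [:int q:] dvd f"
    using assms(4) by (metis const_poly_dvd_iff)
  ultimately obtain Z where Z: "finite Z" "card Z \<le> D"
      "\<And>x. int q dvd poly f x \<Longrightarrow> \<exists>z\<in>Z. int q dvd x - z"
    using poly_roots_mod[OF assms(1)] by blast
  have "{x \<in> int_box R. int q dvd (\<Sum>e\<le>D. c e * x ^ e)} \<subseteq> (\<Union>z\<in>Z. {x \<in> int_box R. int q dvd x - z})"
    using Z(3) by (auto simp: f_def poly_sum poly_monom)
  then have "card {x \<in> int_box R. int q dvd (\<Sum>e\<le>D. c e * x ^ e)}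
      \<le> card (\<Union>z\<in>Z. {x \<in> int_box R. int q dvd x - z})"
    using Z(1) by (intro card_mono) auto
  also have "\<dots> \<le> (\<Sum>z\<in>Z. card {x \<in> int_box R. int q dvd x - z})"
    by (rule card_UN_le[OF Z(1)])
  finally have "real (card {x \<in> int_box R. int q dvd (\<Sum>e\<le>D. c e * x ^ e)})
      \<le> (\<Sum>z\<in>Z. real (card {x \<in> int_box R. int q dvd x - z}))"
    unfolding of_nat_sum[symmetric] of_nat_le_iff .
  also have "\<dots> \<le> (\<Sum>z\<in>Z. 2 * R / q + 1)"
    by (intro sum_mono card_residue_class_in_box assms)
  also have "\<dots> \<le> D * (2 * R / q + 1)"
    unfolding sum_constant using Z(2) assms(2) by (intro mult_right_mono) auto
  finally show ?thesis .
qed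

section \<open>Lists with few free entries\<close>

text \<open>The map \<open>E\<close> is a guide: it assigns to the entries read so far a small set of candidates for the
  next entry. An entry outside its candidate set is free.\<close>

definition free_positions :: "('a list \<Rightarrow> 'a set) \<Rightarrow> 'a list \<Rightarrow> nat set"
  where "free_positions E w = {j. j < length w \<and> w ! j \<notin> E (take j w)}"

definition guided_lists :: "'a set \<Rightarrow> ('a list \<Rightarrow> 'a set) \<Rightarrow> nat \<Rightarrow> nat \<Rightarrow> 'a list set"
  where "guided_lists B E m t = {w. length w = m \<and> card (free_positions E w) \<le> t \<and>
    (\<forall>j<m. w ! j \<in> E (take j w) \<union> B)}"

text \<open>An entry offers at most \<open>\<alpha>\<close> choices if it follows the guide and at most \<open>\<alpha> * \<beta>\<close> if it is free, so
  free entries cost an additional factor \<open>\<beta>\<close>; the factor \<open>2 ^ m\<close> accounts for which entries are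
  free.\<close>

lemma card_guided_lists:
  fixes \<alpha> \<beta> :: real
  assumes B: "finite B" "real (card B) \<le> \<alpha> * \<beta>"
    and E: "\<And>w. finite (E w)" "\<And>w. real (card (E w)) \<le> \<alpha>"
    and "\<beta> \<ge> 1"
  shows "finite (guided_lists B E m t) \<and> real (card (guided_lists B E m t)) \<le> (2 * \<alpha>) ^ m * \<beta> ^ t"
proof (induction m arbitrary: t)
  case 0
  have "guided_lists B E 0 t = {[]}"
    by (auto simp: guided_lists_def free_positions_def)
  with \<open>\<beta> \<ge> 1\<close> show ?case by simp
next
  case (Suc m)
  have "\<alpha> \<ge> 0" using E(2)[of "[]"] by linarith
  define X where "X = guided_lists B E m"
  \<comment> \<open>The lists whose last entry follows the guide (\<open>Y1\<close>) or is free (\<open>Y2\<close>).\<close>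
  define Y1 where "Y1 = (\<lambda>(w, x). w @ [x]) ` (SIGMA w:X t. E w)"
  define Y2 where "Y2 = (if t = 0 then {} else (\<lambda>(w, x). w @ [x]) ` (X (t - 1) \<times> B))"
  have free_snoc: "free_positions E (w @ [x]) =
      free_positions E w \<union> (if x \<in> E w then {} else {length w})" for w x
    by (auto simp: free_positions_def nth_append less_Suc_eq)
  have fin_free: "finite (free_positions E w)" and not_free: "length w \<notin> free_positions E w" for w
    by (auto simp: free_positions_def)
  have X: "finite (X t)" "real (card (X t)) \<le> (2 * \<alpha>) ^ m * \<beta> ^ t" for t
    using Suc.IH by (auto simp: X_def)
  have "guided_lists B E (Suc m) t \<subseteq> Y1 \<union> Y2"
  proof
    fix v assume v: "v \<in> guided_lists B E (Suc m) t"
    then obtain w x where vw: "v = w @ [x]" "length w = m"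
      by (auto simp: guided_lists_def length_Suc_conv_rev)
    have wB: "w ! j \<in> E (take j w) \<union> B" if "j < m" for j
      using v that vw by (auto simp: guided_lists_def nth_append dest!: spec[of _ j])
    have x: "x \<in> E w \<union> B"
      using v vw by (auto simp: guided_lists_def nth_append dest!: spec[of _ m])
    have cv: "card (free_positions E v) \<le> t"
      using v by (simp add: guided_lists_def)
    show "v \<in> Y1 \<union> Y2"
    proof (cases "x \<in> E w")
      case True
      then have "w \<in> X t"
        using cv wB vw by (simp add: X_def guided_lists_def free_snoc)
      with True show ?thesis by (auto simp: Y1_def vw)
    next
      case False
      then have "Suc (card (free_positions E w)) \<le> t"
        using cv fin_free[of w] not_free[of w] vw by (simp add: free_snoc)
      then have "t \<noteq> 0" "w \<in> X (t - 1)"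
        using wB vw by (auto simp: X_def guided_lists_def)
      with False x show ?thesis by (auto simp: Y2_def vw)
    qed
  qed
  moreover have finY: "finite Y1" "finite Y2"
    using X B E by (auto simp: Y1_def Y2_def)
  ultimately have fin: "finite (guided_lists B E (Suc m) t)"
    and le: "card (guided_lists B E (Suc m) t) \<le> card Y1 + card Y2"
    by (auto intro: finite_subset order_trans[OF card_mono card_Un_le])
  have "card Y1 \<le> (\<Sum>w\<in>X t. card (E w))"
    unfolding Y1_def using X E
    by (metis card_SigmaI card_image_le finite_SigmaI)
  then have "real (card Y1) \<le> (\<Sum>w\<in>X t. real (card (E w)))"
    unfolding of_nat_sum[symmetric] of_nat_le_iff .
  also have "\<dots> \<le> (\<Sum>w\<in>X t. \<alpha>)"
    by (intro sum_mono E)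
  also have "\<dots> \<le> (2 * \<alpha>) ^ m * \<beta> ^ t * \<alpha>"
    unfolding sum_constant using X(2) \<open>\<alpha> \<ge> 0\<close> by (rule mult_right_mono)
  finally have Y1: "real (card Y1) \<le> (2 * \<alpha>) ^ m * \<beta> ^ t * \<alpha>" .
  have Y2: "real (card Y2) \<le> (2 * \<alpha>) ^ m * \<beta> ^ t * \<alpha>"
  proof (cases t)
    case 0
    then show ?thesis using \<open>\<alpha> \<ge> 0\<close> \<open>\<beta> \<ge> 1\<close> by (simp add: Y2_def)
  next
    case (Suc t')
    have "card Y2 = card ((\<lambda>(w, x). w @ [x]) ` (X t' \<times> B))"
      by (simp add: Y2_def Suc)
    also have "\<dots> \<le> card (X t' \<times> B)"
      by (intro card_image_le finite_cartesian_product X(1) B(1))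
    also have "\<dots> = card (X t') * card B"
      by (rule card_cartesian_product)
    finally have "real (card Y2) \<le> real (card (X t')) * real (card B)"
      unfolding of_nat_mult[symmetric] of_nat_le_iff .
    also have "\<dots> \<le> ((2 * \<alpha>) ^ m * \<beta> ^ t') * (\<alpha> * \<beta>)"
      using X B \<open>\<alpha> \<ge> 0\<close> \<open>\<beta> \<ge> 1\<close> by (intro mult_mono) auto
    finally show ?thesis by (simp add: Suc mult_ac)
  qed
  from le have "real (card (guided_lists B E (Suc m) t)) \<le> real (card Y1) + real (card Y2)"
    by linarith
  also have "\<dots> \<le> (2 * \<alpha>) ^ Suc m * \<beta> ^ t"
    using Y1 Y2 by (simp add: mult_ac)
  finally show ?case using fin by blast
qed

section \<open>Large prime divisors\<close>

lemma prod_primes_dvd: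
  fixes n :: nat
  assumes "finite A" "\<And>p. p \<in> A \<Longrightarrow> prime p \<and> p dvd n"
  shows "\<Prod>A dvd n"
  using assms
proof (induction A)
  case (insert p A)
  have "coprime p (\<Prod>A)"
    using insert by (intro prod_coprime_right) (auto intro: primes_coprime)
  with insert show ?case by (auto intro: divides_mult)
qed simp

text \<open>The product of \<open>g + h\<close> primes above \<open>R\<close> exceeds \<open>2 ^ h * R ^ g\<close>, hence \<open>h * R ^ g\<close>. The bound is
  independent of \<open>R\<close>.\<close>

lemma card_large_prime_divisors:
  fixes R :: real and v :: int
  assumes "v \<noteq> 0" "\<bar>real_of_int v\<bar> \<le> real h * R ^ g" "R \<ge> 2"
  shows "finite {p. prime p \<and> R < real p \<and> int p dvd v}"
    "card {p. prime p \<and> R < real p \<and> int p dvd v} \<le> g + h"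
proof -
  define A where "A = {p. prime p \<and> R < real p \<and> int p dvd v}"
  have "A \<subseteq> {..nat \<bar>v\<bar>}"
    using assms(1) by (auto simp: A_def dest!: dvd_imp_le_int[rotated])
  then have fin: "finite A" by (rule finite_subset) simp
  then show "finite {p. prime p \<and> R < real p \<and> int p dvd v}" by (simp add: A_def)
  have "\<Prod>A dvd nat \<bar>v\<bar>"
    using fin by (intro prod_primes_dvd) (auto simp: A_def)
  then have "\<Prod>A \<le> nat \<bar>v\<bar>"
    using assms(1) by (intro dvd_imp_le) auto
  then have prod_le: "(\<Prod>p\<in>A. real p) \<le> \<bar>real_of_int v\<bar>"
    unfolding of_nat_prod[symmetric] by linarith
  have "R ^ card A = (\<Prod>p\<in>A. R)" by simp
  also have "\<dots> \<le> (\<Prod>p\<in>A. real p)"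
    using assms(3) by (intro prod_mono) (auto simp: A_def)
  finally have le: "R ^ card A \<le> real h * R ^ g"
    using prod_le assms(2) by linarith
  show "card {p. prime p \<and> R < real p \<and> int p dvd v} \<le> g + h"
  proof (rule ccontr)
    assume "\<not> ?thesis"
    then have "g + h \<le> card A" by (simp add: A_def)
    then obtain d where d: "card A = g + h + d" by (metis le_iff_add)
    have "real h < 2 ^ h" by (simp add: of_nat_less_two_power)
    also have "\<dots> \<le> R ^ h" using assms(3) by (intro power_mono) auto
    also have "\<dots> \<le> R ^ (h + d)" using assms(3) by (intro power_increasing) auto
    finally have "real h * R ^ g < R ^ (h + d) * R ^ g" using assms(3) by simp
    with le show False by (simp add: d power_add mult_ac)
  qed
qed

section \<open>Substituting coordinates one at a time\<close>

text \<open>A polynomial in a list of variables is a function from exponent lists to coefficients, with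
  exponents at most \<open>D\<close>. Substituting \<open>x\<close> for the first variable leaves a polynomial in the others,
  and folding this over a list \<open>w\<close> substitutes its entries for the first variables.\<close>

definition subst_head :: "nat \<Rightarrow> (nat list \<Rightarrow> int) \<Rightarrow> int \<Rightarrow> nat list \<Rightarrow> int"
  where "subst_head D c x = (\<lambda>\<mu>. \<Sum>i\<le>D. c (i # \<mu>) * x ^ i)"

lemma foldl_subst_head:
  "foldl (subst_head D) c w \<mu> = (\<Sum>e\<in>exponents D (length w). c (e @ \<mu>) * monom_at w e)"
proof (induction w arbitrary: c)
  case (Cons x w)
  have "foldl (subst_head D) c (x # w) \<mu> =
      (\<Sum>e\<in>exponents D (length w). \<Sum>i\<le>D. c (i # e @ \<mu>) * x ^ i * monom_at w e)"
    by (simp add: Cons.IH subst_head_def[of D c x] sum_distrib_right)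
  also have "\<dots> = (\<Sum>i\<le>D. \<Sum>e\<in>exponents D (length w). c (i # e @ \<mu>) * x ^ i * monom_at w e)"
    by (rule sum.swap)
  finally show ?case
    by (simp add: sum_exponents_Suc mult.assoc)
qed simp

lemma abs_monom_at_le:
  assumes "set w \<subseteq> int_box R" "R \<ge> 1" "e \<in> exponents D (length w)"
  shows "\<bar>real_of_int (monom_at w e)\<bar> \<le> R ^ (D * length w)"
  using assms
proof (induction w arbitrary: e)
  case (Cons x w)
  then obtain i e' where e: "e = i # e'" "i \<le> D" "e' \<in> exponents D (length w)"
    by (auto simp: exponents_def length_Suc_conv)
  have "\<bar>real_of_int x\<bar> ^ i \<le> R ^ i"
    using Cons.prems by (intro power_mono) (auto simp: int_box_def)
  also have "\<dots> \<le> R ^ D"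
    using Cons.prems e by (intro power_increasing) auto
  finally have "\<bar>real_of_int x\<bar> ^ i * \<bar>real_of_int (monom_at w e')\<bar> \<le> R ^ D * R ^ (D * length w)"
    using Cons e by (intro mult_mono) auto
  then show ?case
    by (simp add: e abs_mult power_abs power_add)
qed simp

text \<open>A system of nonzero integer polynomials \<open>c S\<close> in \<open>n\<close> variables, one for each \<open>s\<close>-element set \<open>S\<close> of
  variables, which involves the variables in \<open>S\<close> only.\<close>

locale elimination_system =
  fixes n s D :: nat and c :: "nat set \<Rightarrow> nat list \<Rightarrow> int"
  assumes support: "\<And>S e. S \<subseteq> {..<n} \<Longrightarrow> card S = s \<Longrightarrow> c S e \<noteq> 0 \<Longrightarrow>
      e \<in> exponents D n \<and> (\<forall>j<n. j \<notin> S \<longrightarrow> e ! j = 0)"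
    and nonzero: "\<And>S. S \<subseteq> {..<n} \<Longrightarrow> card S = s \<Longrightarrow> \<exists>e. c S e \<noteq> 0"
begin

definition subsets :: "nat set set"
  where "subsets = {S. S \<subseteq> {..<n} \<and> card S = s}"

text \<open>After the entries of \<open>w\<close> have been substituted, the polynomial that remains is zero modulo \<open>q\<close>
  in all coefficients; for \<open>q = 0\<close>, it is zero.\<close>

definition vanishes :: "nat \<Rightarrow> nat set \<Rightarrow> int list \<Rightarrow> bool"
  where "vanishes q S w \<longleftrightarrow> (\<forall>\<mu>. int q dvd foldl (subst_head D) (c S) w \<mu>)"

text \<open>The candidates for the coordinate after \<open>w\<close> at which some polynomial turns from nonzero to zero
  modulo \<open>q\<close>.\<close>

definition determined :: "nat \<Rightarrow> real \<Rightarrow> int list \<Rightarrow> int set"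
  where "determined q R w = {x \<in> int_box R.
    \<exists>S\<in>subsets. length w \<in> S \<and> \<not> vanishes q S w \<and> vanishes q S (w @ [x])}"

lemma finite_subsets: "finite subsets" and card_subsets_le: "card subsets \<le> 2 ^ n"
proof -
  have sub: "subsets \<subseteq> Pow {..<n}" by (auto simp: subsets_def)
  then show "finite subsets" by (rule finite_subset) simp
  from sub have "card subsets \<le> card (Pow {..<n})" by (intro card_mono) auto
  then show "card subsets \<le> 2 ^ n" by (simp add: card_Pow)
qed

lemma vanishes_0_imp: "vanishes 0 S w \<Longrightarrow> vanishes q S w"
  by (simp add: vanishes_def)

lemma not_vanishes_0_Nil: "S \<in> subsets \<Longrightarrow> \<not> vanishes 0 S []"
  using nonzero by (auto simp: vanishes_def subsets_def)

lemma finite_determined [simp]: "finite (determined q R w)"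
  by (rule finite_subset[OF _ finite_int_box[of R]]) (auto simp: determined_def)

text \<open>What remains after a partial substitution is still a polynomial in the remaining variables that
  belong to \<open>S\<close>.\<close>

lemma partial_support:
  assumes "S \<in> subsets" "length w < n" "foldl (subst_head D) (c S) w \<mu> \<noteq> 0"
  obtains i \<mu>' where "\<mu> = i # \<mu>'" "i \<le> D" "length w \<notin> S \<Longrightarrow> i = 0"
proof -
  have "\<exists>e\<in>exponents D (length w). c S (e @ \<mu>) * monom_at w e \<noteq> 0"
    using assms(3) unfolding foldl_subst_head by (meson sum.neutral)
  then obtain e where e: "length e = length w" "c S (e @ \<mu>) \<noteq> 0"
    by (auto simp: exponents_def)
  with support[of S "e @ \<mu>"] assms(1)
  have "e @ \<mu> \<in> exponents D n" "length w \<notin> S \<Longrightarrow> (e @ \<mu>) ! length w = 0"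
    using assms(2) by (auto simp: subsets_def)
  with e(1) assms(2) show thesis
    by (cases \<mu>) (auto simp: nth_append exponents_def intro!: that)
qed

text \<open>A candidate for \<open>S\<close> is a root modulo \<open>q\<close> of the polynomial formed by the coefficients at
  \<open>e # \<mu>'\<close> for varying \<open>e\<close>, and \<open>\<mu>'\<close> can be chosen such that these are not all zero modulo \<open>q\<close>.\<close>

lemma card_determined_le:
  assumes "q = 0 \<or> prime q" "R \<ge> 0"
  shows "real (card (determined q R w)) \<le> 2 ^ n * (D * (2 * R / q + 1))"
proof -
  define Z where "Z S = {x \<in> int_box R. length w \<in> S \<and> \<not> vanishes q S w \<and> vanishes q S (w @ [x])}" for S
  have Z: "finite (Z S)" for S by (simp add: Z_def)
  have card_Z: "real (card (Z S)) \<le> D * (2 * R / q + 1)" if S: "S \<in> subsets" for S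
  proof (cases "Z S = {}")
    case True
    then show ?thesis using assms(2) by simp
  next
    case False
    then have "length w < n" "\<not> vanishes q S w"
      using S by (auto simp: Z_def subsets_def)
    then obtain \<mu> where \<mu>: "\<not> int q dvd foldl (subst_head D) (c S) w \<mu>"
      by (auto simp: vanishes_def)
    then have "foldl (subst_head D) (c S) w \<mu> \<noteq> 0" by auto
    then obtain i \<mu>' where i: "\<mu> = i # \<mu>'" "i \<le> D"
      by (rule partial_support[OF S \<open>length w < n\<close>])
    define f where "f e = foldl (subst_head D) (c S) w (e # \<mu>')" for e
    have "Z S \<subseteq> {x \<in> int_box R. int q dvd (\<Sum>e\<le>D. f e * x ^ e)}"
      by (auto simp: Z_def vanishes_def subst_head_def[of D _ x for x] f_def)
    then have "card (Z S) \<le> card {x \<in> int_box R. int q dvd (\<Sum>e\<le>D. f e * x ^ e)}"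
      by (intro card_mono) auto
    moreover have "\<not> int q dvd f i"
      using \<mu> i by (simp add: f_def)
    ultimately show ?thesis
      using card_roots_mod_in_box[of q R i D f] assms i(2) by linarith
  qed
  have "determined q R w \<subseteq> (\<Union>S\<in>subsets. Z S)"
    by (auto simp: determined_def Z_def)
  then have "card (determined q R w) \<le> card (\<Union>S\<in>subsets. Z S)"
    using finite_subsets Z by (intro card_mono) auto
  also have "\<dots> \<le> (\<Sum>S\<in>subsets. card (Z S))"
    by (rule card_UN_le[OF finite_subsets])
  finally have "real (card (determined q R w)) \<le> (\<Sum>S\<in>subsets. real (card (Z S)))"
    unfolding of_nat_sum[symmetric] of_nat_le_iff .
  also have "\<dots> \<le> (\<Sum>S\<in>subsets. D * (2 * R / q + 1))"
    by (intro sum_mono card_Z) simp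
  also have "\<dots> = card subsets * (D * (2 * R / q + 1))"
    by (rule sum_constant)
  also have "\<dots> \<le> 2 ^ n * (D * (2 * R / q + 1))"
  proof (rule mult_right_mono)
    show "real (card subsets) \<le> 2 ^ n"
      using card_subsets_le by (metis of_nat_le_iff of_nat_numeral of_nat_power)
  qed (use assms(2) in auto)
  finally show ?thesis .
qed

text \<open>Substituting for a variable that does not occur leaves all coefficients unchanged.\<close>

lemma vanishing_step_in_subset:
  assumes S: "S \<in> subsets" and "length w < n" "\<not> vanishes q S w" "vanishes q S (w @ [x])"
  shows "length w \<in> S"
proof (rule ccontr)
  assume notin: "length w \<notin> S"
  define f where "f = foldl (subst_head D) (c S) w"
  have head0: "\<exists>\<mu>'. \<mu> = 0 # \<mu>'" if "f \<mu> \<noteq> 0" for \<mu>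
    using partial_support[OF S assms(2) that[unfolded f_def]] notin by blast
  from assms(3) obtain \<mu> where \<mu>: "\<not> int q dvd f \<mu>"
    by (auto simp: vanishes_def f_def)
  then obtain \<mu>' where \<mu>': "\<mu> = 0 # \<mu>'"
    using head0[of \<mu>] by force
  have "f (i # \<mu>') * x ^ i = (if i = 0 then f \<mu> else 0)" for i
    using head0[of "i # \<mu>'"] \<mu>' by auto
  then have "foldl (subst_head D) (c S) (w @ [x]) \<mu>' = f \<mu>"
    by (simp add: subst_head_def f_def[symmetric])
  with assms(4) \<mu> show False
    by (metis vanishes_def)
qed

text \<open>Each polynomial is nonzero modulo \<open>q\<close> at the start and zero at the end, so it turns to zero at some
  coordinate in \<open>S\<close>, and that coordinate is determined. Hence the undetermined coordinates contain
  no set \<open>S\<close> of size \<open>s\<close>.\<close>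

lemma card_undetermined_less:
  assumes a: "length a = n" "set a \<subseteq> int_box R"
    and start: "\<And>S. S \<in> subsets \<Longrightarrow> \<not> vanishes q S []"
    and final: "\<And>S. S \<in> subsets \<Longrightarrow> vanishes q S a"
  shows "card {j. j < n \<and> a ! j \<notin> determined q R (take j a)} < s"
proof (rule ccontr)
  assume "\<not> ?thesis"
  then obtain S where S: "S \<subseteq> {j. j < n \<and> a ! j \<notin> determined q R (take j a)}" "card S = s"
    by (meson not_less obtain_subset_with_card_n)
  then have "S \<in> subsets" by (auto simp: subsets_def)
  have "\<exists>j<n. \<not> vanishes q S (take j a) \<and> vanishes q S (take (Suc j) a)"
  proof (rule ccontr)
    assume no: "\<not> ?thesis"
    have "j \<le> n \<Longrightarrow> \<not> vanishes q S (take j a)" for j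
      using start[OF \<open>S \<in> subsets\<close>] no by (induction j) (auto simp: Suc_le_eq)
    from this[of n] show False
      using final[OF \<open>S \<in> subsets\<close>] a by simp
  qed
  then obtain j where j: "j < n" "\<not> vanishes q S (take j a)" "vanishes q S (take j a @ [a ! j])"
    using a by (metis take_Suc_conv_app_nth)
  with vanishing_step_in_subset[OF \<open>S \<in> subsets\<close>, of "take j a"] a have "j \<in> S"
    by simp
  moreover have "a ! j \<in> int_box R"
    using a j(1) by (simp add: nth_mem subset_iff)
  ultimately have "a ! j \<in> determined q R (take j a)"
    using j a \<open>S \<in> subsets\<close> by (auto simp: determined_def)
  with S \<open>j \<in> S\<close> show False by blast
qed

text \<open>A point at which all polynomials vanish modulo \<open>q\<close> is a list guided by \<open>determined q R\<close> with at most
  \<open>s - 1\<close> free entries. The parameters \<open>\<alpha>\<close> and \<open>\<beta>\<close> are left open because a prime \<open>q \<le> R\<close> needs \<open>\<beta> = q\<close>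
  whereas \<open>q = 0\<close> needs \<open>\<beta>\<close> of the order of \<open>R\<close>.\<close>

lemma card_solutions_mod_le:
  assumes q: "q = 0 \<or> prime q" and "R \<ge> 0" and "s \<ge> 1"
    and start: "\<And>S. S \<in> subsets \<Longrightarrow> \<not> vanishes q S []"
    and \<alpha>: "\<alpha> \<ge> 2 ^ n * ((real D + 1) * (2 * R / q + 1))" and \<beta>: "\<beta> \<ge> 1" "2 * R + 1 \<le> \<alpha> * \<beta>"
  defines "X \<equiv> {a. length a = n \<and> set a \<subseteq> int_box R \<and> (\<forall>S\<in>subsets. vanishes q S a)}"
  shows "finite X" "real (card X) \<le> (2 * \<alpha>) ^ n * \<beta> ^ (s - 1)"
proof -
  define Y where "Y = guided_lists (int_box R) (determined q R) n (s - 1)"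
  have "X \<subseteq> Y"
  proof
    fix a assume "a \<in> X"
    then have a: "length a = n" "set a \<subseteq> int_box R" "\<And>S. S \<in> subsets \<Longrightarrow> vanishes q S a"
      by (auto simp: X_def)
    have "card (free_positions (determined q R) a) \<le> s - 1"
      using card_undetermined_less[OF a(1,2) start a(3)] a(1) by (simp add: free_positions_def)
    then show "a \<in> Y"
      using a by (auto simp: Y_def guided_lists_def subset_iff)
  qed
  moreover have "finite Y \<and> real (card Y) \<le> (2 * \<alpha>) ^ n * \<beta> ^ (s - 1)"
    unfolding Y_def
  proof (rule card_guided_lists)
    show "real (card (determined q R w)) \<le> \<alpha>" for w
    proof -
      have "2 ^ n * (D * (2 * R / q + 1)) \<le> 2 ^ n * ((real D + 1) * (2 * R / q + 1))"
        using assms(2) by (intro mult_left_mono mult_right_mono) auto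
      with card_determined_le[OF q assms(2), of w] \<alpha> show ?thesis by linarith
    qed
    show "real (card (int_box R)) \<le> \<alpha> * \<beta>"
      using card_int_box[OF assms(2)] \<beta> by linarith
  qed (use \<beta> in auto)
  ultimately show "finite X" "real (card X) \<le> (2 * \<alpha>) ^ n * \<beta> ^ (s - 1)"
    using finite_subset card_mono[of Y X] by (auto intro: order_trans[of _ "real (card Y)"])
qed

definition coeff_bound :: nat
  where "coeff_bound = (\<Sum>S\<in>subsets. \<Sum>e\<in>exponents D n. nat \<bar>c S e\<bar>)"

lemma abs_coeff_le:
  assumes "S \<in> subsets"
  shows "\<bar>c S e\<bar> \<le> int coeff_bound"
proof (cases "c S e = 0")
  case False
  then have "e \<in> exponents D n"
    using support[of S e] assms by (auto simp: subsets_def)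
  then have "nat \<bar>c S e\<bar> \<le> (\<Sum>e\<in>exponents D n. nat \<bar>c S e\<bar>)"
    by (intro member_le_sum) auto
  also have "\<dots> \<le> coeff_bound"
    unfolding coeff_bound_def using assms finite_subsets
    by (intro member_le_sum[of S subsets "\<lambda>S. \<Sum>e\<in>exponents D n. nat \<bar>c S e\<bar>"]) auto
  finally show ?thesis by linarith
qed simp

lemma abs_partial_value_le:
  assumes "S \<in> subsets" "set w \<subseteq> int_box R" "R \<ge> 1" "length w \<le> n"
  shows "\<bar>real_of_int (foldl (subst_head D) (c S) w \<mu>)\<bar>
    \<le> real ((D + 1) ^ n * coeff_bound) * R ^ (D * n)"
proof -
  have "\<bar>real_of_int (foldl (subst_head D) (c S) w \<mu>)\<bar>
      \<le> (\<Sum>e\<in>exponents D (length w). \<bar>real_of_int (c S (e @ \<mu>) * monom_at w e)\<bar>)"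
    unfolding foldl_subst_head of_int_sum by (rule sum_abs)
  also have "\<dots> \<le> (\<Sum>e\<in>exponents D (length w). real coeff_bound * R ^ (D * n))"
  proof (rule sum_mono)
    fix e assume e: "e \<in> exponents D (length w)"
    have "\<bar>real_of_int (monom_at w e)\<bar> \<le> R ^ (D * length w)"
      by (rule abs_monom_at_le[OF assms(2,3) e])
    also have "\<dots> \<le> R ^ (D * n)"
      using assms(3,4) by (intro power_increasing) auto
    finally have "\<bar>real_of_int (monom_at w e)\<bar> \<le> R ^ (D * n)" .
    moreover have "\<bar>real_of_int (c S (e @ \<mu>))\<bar> \<le> real coeff_bound"
      using abs_coeff_le[OF assms(1), of "e @ \<mu>"] by linarith
    ultimately show "\<bar>real_of_int (c S (e @ \<mu>) * monom_at w e)\<bar> \<le> real coeff_bound * R ^ (D * n)"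
      unfolding of_int_mult abs_mult using assms(3) by (intro mult_mono) auto
  qed
  also have "\<dots> = real ((D + 1) ^ length w) * (real coeff_bound * R ^ (D * n))"
    by (simp only: sum_constant card_exponents)
  also have "\<dots> \<le> real ((D + 1) ^ n) * (real coeff_bound * R ^ (D * n))"
  proof (rule mult_right_mono)
    show "real ((D + 1) ^ length w) \<le> real ((D + 1) ^ n)"
      unfolding of_nat_le_iff using assms(4) by (intro power_increasing) auto
  qed (use assms(3) in auto)
  finally show ?thesis by (simp add: mult.assoc)
qed

text \<open>The primes that could explain why some polynomial has become zero modulo a prime without becoming
  zero.\<close>

definition distinguishing_primes :: "real \<Rightarrow> int list \<Rightarrow> nat set"
  where "distinguishing_primes R w = {p. prime p \<and> R < real p \<and>
    (\<exists>S\<in>subsets. vanishes p S w \<and> \<not> vanishes 0 S w)}"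

lemma card_distinguishing_primes_le:
  assumes "set w \<subseteq> int_box R" "R \<ge> 2" "length w \<le> n"
  shows "finite (distinguishing_primes R w)"
    "card (distinguishing_primes R w) \<le> 2 ^ n * (D * n + (D + 1) ^ n * coeff_bound)"
proof -
  define A where "A S = {p. prime p \<and> R < real p \<and> vanishes p S w \<and> \<not> vanishes 0 S w}" for S
  have A: "finite (A S) \<and> card (A S) \<le> D * n + (D + 1) ^ n * coeff_bound" if S: "S \<in> subsets" for S
  proof (cases "vanishes 0 S w")
    case True
    then show ?thesis by (simp add: A_def)
  next
    case False
    then obtain \<mu> where \<mu>: "foldl (subst_head D) (c S) w \<mu> \<noteq> 0"
      by (auto simp: vanishes_def)
    define v where "v = foldl (subst_head D) (c S) w \<mu>"
    define V where "V = {p. prime p \<and> R < real p \<and> int p dvd v}"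
    have "\<bar>real_of_int v\<bar> \<le> real ((D + 1) ^ n * coeff_bound) * R ^ (D * n)"
      unfolding v_def using assms by (intro abs_partial_value_le[OF S]) auto
    then have V: "finite V" "card V \<le> D * n + (D + 1) ^ n * coeff_bound"
      using card_large_prime_divisors[of v "(D + 1) ^ n * coeff_bound" R "D * n"] \<mu> assms(2)
      by (simp_all add: V_def v_def)
    have "A S \<subseteq> V"
      by (auto simp: A_def V_def v_def vanishes_def)
    then show ?thesis
      using V(2) finite_subset[OF _ V(1)] card_mono[OF V(1), of "A S"] by auto
  qed
  have eq: "distinguishing_primes R w = (\<Union>S\<in>subsets. A S)"
    by (auto simp: distinguishing_primes_def A_def)
  show "finite (distinguishing_primes R w)"
    unfolding eq using A finite_subsets by blast
  have "card (distinguishing_primes R w) \<le> (\<Sum>S\<in>subsets. card (A S))"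
    unfolding eq by (rule card_UN_le[OF finite_subsets])
  also have "\<dots> \<le> (\<Sum>S\<in>subsets. D * n + (D + 1) ^ n * coeff_bound)"
    using A by (intro sum_mono) blast
  also have "\<dots> \<le> 2 ^ n * (D * n + (D + 1) ^ n * coeff_bound)"
    using card_subsets_le by simp
  finally show "card (distinguishing_primes R w) \<le> 2 ^ n * (D * n + (D + 1) ^ n * coeff_bound)" .
qed

end

section \<open>Solutions modulo a large unknown prime\<close>

text \<open>The coordinates of a point with the prime recorded after the coordinate \<open>j\<close>, at which it can first
  be recognised.\<close>

definition insert_prime :: "nat \<Rightarrow> nat \<Rightarrow> int list \<Rightarrow> int list"
  where "insert_prime j p a = take (Suc j) a @ int p # drop (Suc j) a"

definition remove_prime :: "nat \<Rightarrow> int list \<Rightarrow> int list"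
  where "remove_prime j w = take (Suc j) w @ drop (Suc (Suc j)) w"

lemma remove_insert_prime: "j < length a \<Longrightarrow> remove_prime j (insert_prime j p a) = a"
  by (simp add: remove_prime_def insert_prime_def min_def)

context elimination_system
begin

text \<open>The guide for such lists. Up to the coordinate \<open>j\<close> it works over \<open>\<int>\<close>, then it lists the primes
  compatible with the coordinates read, and after that it works modulo the prime that has been
  read. The side conditions, which hold for the lists of interest, keep the candidate set small for
  arbitrary lists.\<close>

definition prime_guide :: "real \<Rightarrow> nat \<Rightarrow> int list \<Rightarrow> int set"
  where "prime_guide R j w =
    (if length w \<le> j then determined 0 R w
     else if length w = Suc j then
       (if set w \<subseteq> int_box R \<and> Suc j \<le> n then int ` distinguishing_primes R w else {})
     else
       (let p = nat (w ! Suc j) in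
         if prime p \<and> R < real p then determined p R (remove_prime j w) else {}))"

text \<open>The first summand bounds the determined candidates, as \<open>2 * R / q + 1 \<le> 3\<close> for \<open>q = 0\<close> and for
  \<open>q > R\<close>; the second one bounds the distinguishing primes.\<close>

definition guide_size :: real
  where "guide_size = 2 ^ n * ((real D + 1) * 3) + 2 ^ n * (D * n + (D + 1) ^ n * coeff_bound)"

lemma guide_size_ge: "guide_size \<ge> 2 ^ n * ((real D + 1) * 3)" "guide_size \<ge> 1"
proof -
  show "guide_size \<ge> 2 ^ n * ((real D + 1) * 3)"
    by (simp add: guide_size_def)
  moreover have "1 * (1 * 1) \<le> 2 ^ n * ((real D + 1) * 3)"
    by (intro mult_mono) auto
  ultimately show "guide_size \<ge> 1" by linarith
qed

lemma card_prime_guide_le: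
  assumes "R \<ge> 2"
  shows "finite (prime_guide R j w)" "real (card (prime_guide R j w)) \<le> guide_size"
proof -
  have det: "real (card (determined q R v)) \<le> guide_size"
    if q: "q = 0 \<or> prime q" "q = 0 \<or> R < real q" for q v
  proof -
    have "2 * R / q \<le> 2"
      using q assms by (auto simp: field_simps)
    then have "2 ^ n * (real D * (2 * R / q + 1)) \<le> 2 ^ n * ((real D + 1) * 3)"
      using assms by (intro mult_left_mono mult_mono) auto
    with card_determined_le[OF q(1), of R v] guide_size_ge(1) assms show ?thesis
      by linarith
  qed
  have dist: "finite (int ` distinguishing_primes R w) \<and>
      real (card (int ` distinguishing_primes R w)) \<le> guide_size"
    if w: "set w \<subseteq> int_box R" "length w \<le> n"
  proof -
    have fin: "finite (distinguishing_primes R w)"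
      and "card (distinguishing_primes R w) \<le> 2 ^ n * (D * n + (D + 1) ^ n * coeff_bound)"
      using card_distinguishing_primes_le[OF w(1) assms w(2)] by auto
    then have "real (card (distinguishing_primes R w)) \<le> 2 ^ n * (D * n + (D + 1) ^ n * coeff_bound)"
      using of_nat_mono by fastforce
    also have "\<dots> \<le> guide_size" by (simp add: guide_size_def)
    finally show ?thesis
      using fin by (simp add: card_image)
  qed
  show "finite (prime_guide R j w)" "real (card (prime_guide R j w)) \<le> guide_size"
    using det dist guide_size_ge(2) by (auto simp: prime_guide_def Let_def)
qed

context
  fixes a :: "int list" and j p :: nat and R :: real
  assumes a: "length a = n" "set a \<subseteq> int_box R" and j: "j < n" and p: "prime p" "R < real p"
begin

lemma length_insert_prime: "length (insert_prime j p a) = Suc n"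
  using a j by (simp add: insert_prime_def)

lemma insert_prime_before:
  "i \<le> j \<Longrightarrow> insert_prime j p a ! i = a ! i"
  "i \<le> Suc j \<Longrightarrow> take i (insert_prime j p a) = take i a"
  using a j by (auto simp: insert_prime_def nth_append min_def)

lemma insert_prime_at: "insert_prime j p a ! Suc j = int p"
  using a j by (simp add: insert_prime_def nth_append)

lemma insert_prime_after:
  assumes "j < i" "i < n"
  shows "insert_prime j p a ! Suc i = a ! i"
    and "take (Suc i) (insert_prime j p a) = insert_prime j p (take i a)"
    and "remove_prime j (insert_prime j p (take i a)) = take i a"
    and "insert_prime j p (take i a) ! Suc j = int p"
    and "length (insert_prime j p (take i a)) = Suc i"
proof -
  obtain d where d: "i = Suc j + d"
    using assms(1) by (metis Suc_leI le_Suc_ex)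
  show "insert_prime j p a ! Suc i = a ! i"
    using a assms j by (simp add: insert_prime_def nth_append d)
  show "take (Suc i) (insert_prime j p a) = insert_prime j p (take i a)"
    using a assms j by (simp add: insert_prime_def d min_def drop_take)
  show "remove_prime j (insert_prime j p (take i a)) = take i a"
    using a assms by (intro remove_insert_prime) simp
  show "insert_prime j p (take i a) ! Suc j = int p"
    using a assms j by (simp add: insert_prime_def nth_append d min_def)
  show "length (insert_prime j p (take i a)) = Suc i"
    using a assms j by (simp add: insert_prime_def d min_def)
qed

lemma prime_guide_before: "i \<le> j \<Longrightarrow> prime_guide R j (take i (insert_prime j p a)) = determined 0 R (take i a)"
  using a j by (simp add: insert_prime_before prime_guide_def)

lemma prime_guide_at:
  "prime_guide R j (take (Suc j) (insert_prime j p a)) = int ` distinguishing_primes R (take (Suc j) a)"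
  using a j by (auto simp: insert_prime_before prime_guide_def dest: in_set_takeD)

lemma prime_guide_after:
  assumes "j < i" "i < n"
  shows "prime_guide R j (take (Suc i) (insert_prime j p a)) = determined p R (take i a)"
  using assms p by (simp add: insert_prime_after prime_guide_def)

text \<open>Here \<open>j\<close> is the first coordinate after which vanishing modulo \<open>p\<close> and vanishing over \<open>\<int>\<close> differ. The
  coordinate \<open>j\<close> may be free although it is determined modulo \<open>p\<close>; this accounts for the step from
  \<open>s - 1\<close> to \<open>s\<close>.\<close>

lemma insert_prime_guided:
  assumes agree: "\<And>i S. i \<le> j \<Longrightarrow> S \<in> subsets \<Longrightarrow> vanishes p S (take i a) \<longleftrightarrow> vanishes 0 S (take i a)"
    and split: "\<exists>S\<in>subsets. vanishes p S (take (Suc j) a) \<and> \<not> vanishes 0 S (take (Suc j) a)"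
    and start: "\<And>S. S \<in> subsets \<Longrightarrow> \<not> vanishes p S []"
    and final: "\<And>S. S \<in> subsets \<Longrightarrow> vanishes p S a"
  shows "insert_prime j p a \<in> guided_lists (int_box R) (prime_guide R j) (Suc n) s"
proof -
  define T where "T = {i. i < n \<and> a ! i \<notin> determined p R (take i a)}"
  define w where "w = insert_prime j p a"
  have prime_in: "w ! Suc j \<in> prime_guide R j (take (Suc j) w)"
    using split p unfolding w_def insert_prime_at prime_guide_at
    by (auto simp: distinguishing_primes_def)
  \<comment> \<open>Whether the actual coordinate is a candidate depends only on which polynomials
    vanish before and after it.\<close>
  have same: "determined p R (take i a) \<inter> {a ! i} = determined 0 R (take i a) \<inter> {a ! i}" if "i < j" for i
  proof -
    have "take i a @ [a ! i] = take (Suc i) a"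
      using that a j by (simp add: take_Suc_conv_app_nth)
    then show ?thesis
      using that agree[of i] agree[of "Suc i"] by (auto simp: determined_def)
  qed
  have "free_positions (prime_guide R j) w \<subseteq> insert j ((\<lambda>i. if i \<le> j then i else Suc i) ` T)"
  proof
    fix k assume "k \<in> free_positions (prime_guide R j) w"
    then have k: "k < Suc n" "w ! k \<notin> prime_guide R j (take k w)"
      by (simp_all add: free_positions_def w_def length_insert_prime)
    consider "k < j" | "k = j" | "k = Suc j" | i where "k = Suc i" "j < i"
      by (metis Suc_lessI less_antisym not_less_eq Suc_less_eq2 linorder_neqE_nat)
    then show "k \<in> insert j ((\<lambda>i. if i \<le> j then i else Suc i) ` T)"
    proof cases
      case 1
      then have "a ! k \<notin> determined 0 R (take k a)"
        using k j insert_prime_before(1)[of k] prime_guide_before[of k] by (simp add: w_def)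
      then have "k \<in> T"
        using same[OF 1] 1 j by (auto simp: T_def)
      then show ?thesis using 1 by (auto intro!: image_eqI[of _ _ k])
    next
      case 3
      then show ?thesis using k prime_in by simp
    next
      case 4
      then have "a ! i \<notin> determined p R (take i a)"
        using k insert_prime_after(1)[of i] prime_guide_after[of i] by (simp add: w_def)
      then have "i \<in> T" using 4 k by (simp add: T_def)
      then show ?thesis using 4 by (auto intro!: image_eqI[of _ _ i])
    qed simp
  qed
  then have "card (free_positions (prime_guide R j) w) \<le> card (insert j ((\<lambda>i. if i \<le> j then i else Suc i) ` T))"
    by (intro card_mono) (auto simp: T_def)
  also have "\<dots> \<le> Suc (card T)"
    using card_image_le[of T "\<lambda>i. if i \<le> j then i else Suc i"]
    by (auto simp: card_insert_if T_def)
  also have "\<dots> \<le> s"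
    using card_undetermined_less[OF a start final] by (simp add: T_def)
  finally have "card (free_positions (prime_guide R j) w) \<le> s" .
  moreover have "w ! i \<in> prime_guide R j (take i w) \<union> int_box R" if i: "i < Suc n" for i
  proof (cases "i = Suc j")
    case True
    then show ?thesis using prime_in by simp
  next
    case False
    have "\<exists>k<n. w ! i = a ! k"
    proof (cases "i \<le> j")
      case True
      then show ?thesis using j by (intro exI[of _ i]) (auto simp: w_def insert_prime_before)
    next
      case False
      with \<open>i \<noteq> Suc j\<close> have "i = Suc (i - 1)" "j < i - 1" by auto
      moreover from this have "w ! Suc (i - 1) = a ! (i - 1)"
        unfolding w_def using i by (intro insert_prime_after(1)) auto
      ultimately show ?thesis using i by (intro exI[of _ "i - 1"]) auto
    qed
    then show ?thesis using a by (auto simp: subset_iff)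
  qed
  ultimately show ?thesis
    by (simp add: guided_lists_def w_def[symmetric]) (simp add: w_def length_insert_prime)
qed

end

text \<open>Either all polynomials vanish at the point over \<open>\<int>\<close>, or there is a first coordinate \<open>j\<close> at which the
  prime can be recognised.\<close>

lemma card_large_prime_solutions_le:
  assumes "s \<ge> 1" "R \<ge> 2"
  defines "X \<equiv> {a. length a = n \<and> set a \<subseteq> int_box R \<and>
      (\<exists>p. prime p \<and> R < real p \<and> (\<forall>S\<in>subsets. \<not> vanishes p S []) \<and> (\<forall>S\<in>subsets. vanishes p S a))}"
  shows "finite X" "real (card X) \<le> (real n + 1) * (2 * guide_size) ^ Suc n * (3 * R) ^ s"
proof -
  define Y where "Y j = guided_lists (int_box R) (prime_guide R j) (Suc n) s" for j
  define Z where "Z = {a. length a = n \<and> set a \<subseteq> int_box R \<and> (\<forall>S\<in>subsets. vanishes 0 S a)}"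
  define b where "b = (2 * guide_size) ^ Suc n * (3 * R) ^ s"
  have box: "2 * R + 1 \<le> guide_size * (3 * R)"
  proof -
    have "2 * R + 1 \<le> 1 * (3 * R)" using assms(2) by simp
    also have "\<dots> \<le> guide_size * (3 * R)"
      using assms(2) guide_size_ge(2) by (intro mult_right_mono) auto
    finally show ?thesis .
  qed
  have Y: "finite (Y j) \<and> real (card (Y j)) \<le> b" for j
    unfolding Y_def b_def
  proof (rule card_guided_lists)
    show "real (card (int_box R)) \<le> guide_size * (3 * R)"
      using card_int_box[of R] box assms(2) by linarith
  qed (use card_prime_guide_le assms(2) in auto)
  have "finite Z \<and> real (card Z) \<le> (2 * guide_size) ^ n * (3 * R) ^ (s - 1)"
  proof -
    have "guide_size \<ge> 2 ^ n * ((real D + 1) * (2 * R / real 0 + 1))"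
    proof -
      have "2 ^ n * ((real D + 1) * (2 * R / real 0 + 1)) \<le> 2 ^ n * ((real D + 1) * 3)"
        by (auto intro!: mult_mono)
      with guide_size_ge(1) show ?thesis by linarith
    qed
    then show ?thesis
      using card_solutions_mod_le[of 0 R guide_size "3 * R"] box assms(1,2) not_vanishes_0_Nil
      by (simp add: Z_def)
  qed
  moreover have "(2 * guide_size) ^ n * (3 * R) ^ (s - 1) \<le> b"
    unfolding b_def using guide_size_ge(2) assms(2)
    by (intro mult_mono power_increasing) auto
  ultimately have Z: "finite Z" "real (card Z) \<le> b" by auto
  have "X \<subseteq> Z \<union> (\<Union>j<n. remove_prime j ` Y j)"
  proof
    fix a assume "a \<in> X"
    then obtain p where a: "length a = n" "set a \<subseteq> int_box R" and p: "prime p" "R < real p"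
      and start: "\<And>S. S \<in> subsets \<Longrightarrow> \<not> vanishes p S []"
      and final: "\<And>S. S \<in> subsets \<Longrightarrow> vanishes p S a"
      by (auto simp: X_def)
    show "a \<in> Z \<union> (\<Union>j<n. remove_prime j ` Y j)"
    proof (cases "\<forall>S\<in>subsets. vanishes 0 S a")
      case True
      then show ?thesis using a by (simp add: Z_def)
    next
      case False
      define differ where "differ i \<longleftrightarrow> (\<exists>S\<in>subsets. vanishes p S (take i a) \<and> \<not> vanishes 0 S (take i a))" for i
      have "differ n" using False final a by (auto simp: differ_def)
      moreover have "\<not> differ 0" using start by (simp add: differ_def)
      ultimately obtain j where j: "j < n" "\<forall>i\<le>j. \<not> differ i" "differ (Suc j)"
        using ex_least_nat_less[of differ n] by auto
      have agree: "vanishes p S (take i a) \<longleftrightarrow> vanishes 0 S (take i a)" if "i \<le> j" "S \<in> subsets" for i S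
        using j(2) that vanishes_0_imp[of S "take i a" p] unfolding differ_def by blast
      have split: "\<exists>S\<in>subsets. vanishes p S (take (Suc j) a) \<and> \<not> vanishes 0 S (take (Suc j) a)"
        using j(3) by (simp only: differ_def)
      have "insert_prime j p a \<in> Y j"
        unfolding Y_def by (rule insert_prime_guided[OF a j(1) p agree split start final])
      moreover have "remove_prime j (insert_prime j p a) = a"
        using a j(1) by (intro remove_insert_prime) simp
      ultimately show ?thesis
        using j(1) by (intro UnI2 UN_I[of j] image_eqI[of _ _ "insert_prime j p a"]) auto
    qed
  qed
  moreover have fin: "finite (Z \<union> (\<Union>j<n. remove_prime j ` Y j))"
    using Z Y by auto
  ultimately show "finite X" by (rule finite_subset)
  have "card X \<le> card (Z \<union> (\<Union>j<n. remove_prime j ` Y j))"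
    by (rule card_mono) fact+
  also have "\<dots> \<le> card Z + card (\<Union>j<n. remove_prime j ` Y j)"
    by (rule card_Un_le)
  also have "card (\<Union>j<n. remove_prime j ` Y j) \<le> (\<Sum>j<n. card (remove_prime j ` Y j))"
    by (rule card_UN_le) simp
  also have "\<dots> \<le> (\<Sum>j<n. card (Y j))"
    using Y by (intro sum_mono card_image_le) auto
  finally have "real (card X) \<le> real (card Z + (\<Sum>j<n. card (Y j)))"
    by (simp only: of_nat_le_iff)
  also have "\<dots> = real (card Z) + (\<Sum>j<n. real (card (Y j)))"
    by simp
  also have "\<dots> \<le> b + (\<Sum>j<n. b)"
    using Z Y by (intro add_mono sum_mono) auto
  also have "\<dots> = (real n + 1) * b"
    by (simp add: algebra_simps)
  finally show "real (card X) \<le> (real n + 1) * (2 * guide_size) ^ Suc n * (3 * R) ^ s"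
    by (simp add: b_def mult.assoc)
qed

end

section \<open>Sums over large primes\<close>

lemma binomial_odd_central_le: "(2 * m + 1) choose m \<le> 4 ^ m"
proof -
  have "((2 * m + 1) choose m) + ((2 * m + 1) choose (m + 1)) = (\<Sum>k\<in>{m, m + 1}. (2 * m + 1) choose k)"
    by simp
  also have "\<dots> \<le> (\<Sum>k\<le>2 * m + 1. (2 * m + 1) choose k)"
    by (intro sum_mono2) auto
  also have "\<dots> = 2 ^ (2 * m + 1)"
    by (rule choose_row_sum)
  also have "\<dots> = 2 * 4 ^ m"
    by (simp add: power_mult)
  also have "(2 * m + 1) choose (m + 1) = (2 * m + 1) choose m"
    by (subst binomial_symmetric) auto
  finally show ?thesis by simp
qed

text \<open>Chebyshev's argument: with \<open>m = \<lfloor>x\<rfloor>\<close>, the primes in \<open>(m + 1, 2 * m + 1]\<close> divide the binomial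
  coefficient \<open>(2 * m + 1) choose m\<close>, which is at most \<open>4 ^ m\<close>. The number \<open>m + 1\<close>, which may be a
  prime in the range but cancels in the binomial coefficient, adds at most \<open>1 \<le> x / ln x\<close>.\<close>

lemma card_primes_dyadic_le:
  fixes x :: real
  assumes "x > 1"
  shows "finite {p. prime p \<and> x < real p \<and> real p \<le> 2 * x}"
    "real (card {p. prime p \<and> x < real p \<and> real p \<le> 2 * x}) \<le> x * (ln 4 + 1) / ln x"
proof -
  define A where "A = {p. prime p \<and> x < real p \<and> real p \<le> 2 * x}"
  define m where "m = nat \<lfloor>x\<rfloor>"
  define A' where "A' = {p. prime p \<and> m + 1 < p \<and> p \<le> 2 * m + 1}"
  have m: "real m \<le> x" "x < real m + 1"
    using assms by (simp_all add: m_def)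
  have A: "A \<subseteq> insert (m + 1) A'"
  proof
    fix p assume p: "p \<in> A"
    then have "real m < real p" "real p < real (2 * m + 2)"
      using m by (auto simp: A_def)
    then have "m < p" "p < 2 * m + 2" by (simp_all only: of_nat_less_iff)
    with p show "p \<in> insert (m + 1) A'" by (auto simp: A_def A'_def)
  qed
  have fin': "finite A'"
    by (rule finite_subset[of _ "{..2 * m + 1}"]) (auto simp: A'_def)
  with A have "finite A" by (auto intro: finite_subset)
  then show "finite {p. prime p \<and> x < real p \<and> real p \<le> 2 * x}" by (simp add: A_def)
  have "\<Prod>A' dvd (2 * m + 1) choose m"
  proof (rule prod_primes_dvd[OF fin'], rule conjI)
    fix p assume p: "p \<in> A'"
    then show "prime p" by (simp add: A'_def)
    have "p dvd fact (2 * m + 1)"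
      using p by (simp add: A'_def prime_dvd_fact_iff del: fact_Suc)
    also have "fact (2 * m + 1) = fact m * (fact (m + 1) * ((2 * m + 1) choose m) :: nat)"
      using binomial_fact_lemma[of m "2 * m + 1"] by (simp add: mult.assoc)
    finally show "p dvd (2 * m + 1) choose m"
      using p by (auto simp: A'_def prime_dvd_mult_iff prime_dvd_fact_iff simp del: fact_Suc)
  qed
  then have "\<Prod>A' \<le> (2 * m + 1) choose m"
    by (rule dvd_imp_le) simp
  also have "\<dots> \<le> 4 ^ m" by (rule binomial_odd_central_le)
  finally have "real (\<Prod>A') \<le> real (4 ^ m)" by (simp only: of_nat_le_iff)
  then have "(\<Prod>p\<in>A'. real p) \<le> 4 ^ m" by simp
  moreover have "x ^ card A' \<le> (\<Prod>p\<in>A'. real p)"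
    using prod_mono[of A' "\<lambda>_. x" real] assms m by (auto simp: A'_def)
  ultimately have "x ^ card A' \<le> 4 ^ m" by linarith
  then have "ln (x ^ card A') \<le> ln (4 ^ m)"
    using assms by (intro ln_mono) auto
  then have "card A' * ln x \<le> m * ln 4"
    using assms by (simp add: ln_realpow)
  also have "\<dots> \<le> x * ln 4"
    using m by (intro mult_right_mono) auto
  finally have "card A' * ln x \<le> x * ln 4" .
  moreover have "card A \<le> card A' + 1"
    using card_mono[OF _ A] fin' card_insert_le_m1[of "card A' + 1" A' "m + 1"]
    by (simp add: card_insert_if split: if_splits)
  then have "card A * ln x \<le> (card A' + 1) * ln x"
    using assms by (intro mult_right_mono) auto
  moreover have "ln x \<le> x"
    using ln_le_minus_one[of x] assms by linarith
  ultimately have "card A * ln x \<le> x * (ln 4 + 1)"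
    by (simp add: algebra_simps)
  then show "real (card {p. prime p \<and> x < real p \<and> real p \<le> 2 * x}) \<le> x * (ln 4 + 1) / ln x"
    using assms by (simp add: A_def field_simps)
qed

text \<open>The interval \<open>(2\<^sup>l M, 2\<^sup>l\<^sup>+\<^sup>1 M]\<close> contributes at most \<open>b / 2\<^sup>l\<close>, because \<open>k - 1 \<ge> 1\<close>, and the geometric
  series sums to \<open>2 * b\<close>.\<close>

lemma sum_primes_inverse_power_le:
  fixes M X :: real
  assumes "k \<ge> 2" "M > 1"
  shows "finite {p. prime p \<and> M < real p \<and> real p \<le> X}"
    "(\<Sum>p | prime p \<and> M < real p \<and> real p \<le> X. 1 / real p ^ k) \<le> 2 * (ln 4 + 1) / (M ^ (k - 1) * ln M)"
proof -
  define P where "P x = {p. prime p \<and> M < real p \<and> real p \<le> x}" for x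
  have finP: "finite (P x)" for x
    by (rule finite_subset[of _ "{..nat \<lfloor>x\<rfloor>}"]) (auto simp: P_def le_nat_floor)
  show "finite {p. prime p \<and> M < real p \<and> real p \<le> X}"
    using finP[of X] by (simp add: P_def)
  define b where "b = (ln 4 + 1) / (M ^ (k - 1) * ln M)"
  have "b \<ge> 0" using assms by (simp add: b_def)
  have bound: "(\<Sum>p\<in>P (2 ^ l * M). 1 / real p ^ k) \<le> (2 - 2 / 2 ^ l) * b" for l
  proof (induction l)
    case 0
    have "P M = {}" by (auto simp: P_def)
    then show ?case by simp
  next
    case (Suc l)
    define x where "x = 2 ^ l * M"
    define N where "N = {p. prime p \<and> x < real p \<and> real p \<le> 2 * x}"
    have "1 * M \<le> x" unfolding x_def using assms(2) by (intro mult_right_mono) auto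
    then have x: "M \<le> x" "1 < x" using assms(2) by auto
    have N: "finite N" "real (card N) \<le> x * (ln 4 + 1) / ln x"
      using card_primes_dyadic_le[OF x(2)] by (simp_all add: N_def)
    have "P (2 ^ Suc l * M) = P x \<union> N" "P x \<inter> N = {}"
      using x by (auto simp: P_def N_def x_def)
    then have "(\<Sum>p\<in>P (2 ^ Suc l * M). 1 / real p ^ k) = (\<Sum>p\<in>P x. 1 / real p ^ k) + (\<Sum>p\<in>N. 1 / real p ^ k)"
      using finP N by (simp add: sum.union_disjoint)
    moreover have "(\<Sum>p\<in>N. 1 / real p ^ k) \<le> b / 2 ^ l"
    proof -
      have "(\<Sum>p\<in>N. 1 / real p ^ k) \<le> (\<Sum>p\<in>N. 1 / x ^ k)"
        using x by (intro sum_mono frac_le power_mono) (auto simp: N_def)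
      also have "\<dots> = card N * (1 / x ^ k)" by (rule sum_constant)
      also have "\<dots> \<le> (x * (ln 4 + 1) / ln x) * (1 / x ^ k)"
        using N x by (intro mult_right_mono) auto
      also have "\<dots> = (ln 4 + 1) / ln x * (1 / x ^ (k - 1))"
        using assms(1) x by (simp add: power_eq_if[of x k] field_simps)
      also have "\<dots> \<le> (ln 4 + 1) / ln M * (1 / (2 ^ l * M ^ (k - 1)))"
      proof (intro mult_mono divide_left_mono)
        have "(2::real) ^ l * 1 \<le> 2 ^ l * (2 ^ l) ^ (k - 2)"
          by (intro mult_left_mono) auto
        also have "\<dots> = (2 ^ l) ^ (k - 1)"
          using assms(1) by (metis power_Suc Suc_diff_le Suc_diff_Suc numeral_2_eq_2 One_nat_def Suc_1 diff_Suc_Suc diff_zero Suc_le_D)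
        finally have "(2::real) ^ l * M ^ (k - 1) \<le> (2 ^ l) ^ (k - 1) * M ^ (k - 1)"
          using assms(2) by (intro mult_right_mono) auto
        then show "2 ^ l * M ^ (k - 1) \<le> x ^ (k - 1)"
          by (simp add: x_def power_mult_distrib)
      qed (use assms x in auto)
      also have "\<dots> = b / 2 ^ l" by (simp add: b_def field_simps)
      finally show ?thesis .
    qed
    moreover have "(\<Sum>p\<in>P x. 1 / real p ^ k) \<le> (2 - 2 / 2 ^ l) * b"
      using Suc.IH by (simp add: x_def)
    moreover have "(2 - 2 / 2 ^ l) * b + b / 2 ^ l = (2 - 2 / 2 ^ Suc l) * b"
      by (simp add: field_simps)
    ultimately show ?case by linarith
  qed
  obtain l where l: "X < 2 ^ l * M"
  proof -
    obtain l where "X < 2 ^ l"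
      using real_arch_pow[of 2 X] by auto
    also have "(2::real) ^ l * 1 \<le> 2 ^ l * M"
      using assms(2) by (intro mult_left_mono) auto
    finally show ?thesis using that by simp
  qed
  have "(\<Sum>p\<in>P X. 1 / real p ^ k) \<le> (\<Sum>p\<in>P (2 ^ l * M). 1 / real p ^ k)"
    using l by (intro sum_mono2 finP) (auto simp: P_def)
  also have "\<dots> \<le> (2 - 2 / 2 ^ l) * b" by (rule bound)
  also have "\<dots> \<le> 2 * b" using \<open>b \<ge> 0\<close> by (intro mult_right_mono) auto
  finally show "(\<Sum>p | prime p \<and> M < real p \<and> real p \<le> X. 1 / real p ^ k) \<le> 2 * (ln 4 + 1) / (M ^ (k - 1) * ln M)"
    by (simp add: P_def b_def)
qed

section \<open>Bounds for elimination systems\<close>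

context elimination_system
begin

lemma not_vanishes_Nil:
  assumes "real p > real coeff_bound" "S \<in> subsets"
  shows "\<not> vanishes p S []"
proof
  assume van: "vanishes p S []"
  obtain e where e: "c S e \<noteq> 0"
    using nonzero[of S] assms(2) by (auto simp: subsets_def)
  have "int p dvd c S e"
    using van by (simp add: vanishes_def)
  from dvd_imp_le_int[OF e this] have "int p \<le> \<bar>c S e\<bar>"
    by simp
  with abs_coeff_le[OF assms(2), of e] assms(1) show False by linarith
qed

text \<open>With \<open>\<alpha> = O(R / p)\<close> candidates for a determined coordinate and an additional factor \<open>\<beta> = p\<close> for each
  of the \<open>s - 1\<close> free ones.\<close>

lemma card_solutions_small_prime_le:
  assumes p: "prime p" "real p \<le> R" "real p > real coeff_bound" and s: "1 \<le> s" "s \<le> n"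
  defines "X \<equiv> {a. length a = n \<and> set a \<subseteq> int_box R \<and> (\<forall>S\<in>subsets. vanishes p S a)}"
  shows "finite X" "real (card X) \<le> (2 ^ n * (real D + 1) * 6) ^ n * R ^ n * (1 / real p ^ (n + 1 - s))"
proof -
  have p0: "real p > 0" using p(1) prime_gt_0_nat by simp
  define \<alpha> where "\<alpha> = 2 ^ n * ((real D + 1) * (2 * R / p + 1))"
  have \<beta>: "2 * R + 1 \<le> \<alpha> * real p"
  proof -
    have "2 * R + 1 \<le> 2 * R + real p"
      using prime_gt_0_nat[OF p(1)] by linarith
    also have "\<dots> = 1 * (1 * (2 * R / real p + 1)) * real p"
      using p0 by (simp add: field_simps)
    also have "\<dots> \<le> \<alpha> * real p"
      unfolding \<alpha>_def using p0 p(2) by (intro mult_right_mono mult_mono) auto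
    finally show ?thesis .
  qed
  have X: "finite X \<and> real (card X) \<le> (2 * \<alpha>) ^ n * real p ^ (s - 1)"
    unfolding X_def
    using card_solutions_mod_le[of p R \<alpha> "real p"] p p0 s(1) \<beta> not_vanishes_Nil[OF p(3)] prime_ge_1_nat[OF p(1)]
    by (auto simp: \<alpha>_def)
  then show "finite X" by simp
  have "2 * R / p + 1 \<le> 3 * R / p"
    using p0 p(2) by (simp add: field_simps)
  then have "2 ^ n * ((real D + 1) * (2 * R / p + 1)) \<le> 2 ^ n * ((real D + 1) * (3 * R / p))"
    by (intro mult_left_mono) auto
  moreover have "2 * (2 ^ n * ((real D + 1) * (3 * R / p))) = 2 ^ n * (real D + 1) * 6 * R / p"
    by (simp add: field_simps)
  ultimately have "2 * \<alpha> \<le> 2 ^ n * (real D + 1) * 6 * R / p"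
    unfolding \<alpha>_def by linarith
  moreover have "\<alpha> \<ge> 0" unfolding \<alpha>_def using p0 p(2) by simp
  ultimately have "(2 * \<alpha>) ^ n * real p ^ (s - 1) \<le> (2 ^ n * (real D + 1) * 6 * R / p) ^ n * real p ^ (s - 1)"
    by (intro mult_right_mono power_mono) auto
  also have "\<dots> = (2 ^ n * (real D + 1) * 6) ^ n * R ^ n * (real p ^ (s - 1) / real p ^ n)"
    by (simp add: power_mult_distrib power_divide)
  finally have "(2 * \<alpha>) ^ n * real p ^ (s - 1)
      \<le> (2 ^ n * (real D + 1) * 6) ^ n * R ^ n * (real p ^ (s - 1) / real p ^ n)" .
  moreover have "real p ^ (s - 1) / real p ^ n = 1 / real p ^ (n + 1 - s)"
  proof -
    have "real p ^ n = real p ^ (s - 1) * real p ^ (n + 1 - s)"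
      using s by (simp add: power_add[symmetric])
    then show ?thesis using p0 by simp
  qed
  ultimately have "(2 * \<alpha>) ^ n * real p ^ (s - 1)
      \<le> (2 ^ n * (real D + 1) * 6) ^ n * R ^ n * (1 / real p ^ (n + 1 - s))"
    by (simp only:)
  with X show "real (card X) \<le> (2 ^ n * (real D + 1) * 6) ^ n * R ^ n * (1 / real p ^ (n + 1 - s))"
    by linarith
qed

text \<open>The primes up to \<open>R\<close> are treated one by one, all larger primes together.\<close>

lemma card_solutions_le:
  assumes s: "1 \<le> s" "s < n" and "R \<ge> 2" and M: "M > 1" "M \<ge> real coeff_bound"
  defines "X \<equiv> {a. length a = n \<and> set a \<subseteq> int_box R \<and>
      (\<exists>p. prime p \<and> M < real p \<and> (\<forall>S\<in>subsets. vanishes p S a))}"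
  shows "real (card X) \<le> (2 ^ n * (real D + 1) * 6) ^ n * (2 * (ln 4 + 1)) * (R ^ n / (M ^ (n - s) * ln M)) +
    (real n + 1) * (2 * guide_size) ^ Suc n * 3 ^ s * R ^ s"
proof -
  define K where "K = (2 ^ n * (real D + 1) * 6) ^ n * R ^ n"
  define P where "P = {p. prime p \<and> M < real p \<and> real p \<le> R}"
  define X1 where "X1 p = {a. length a = n \<and> set a \<subseteq> int_box R \<and> (\<forall>S\<in>subsets. vanishes p S a)}" for p
  define X2 where "X2 = {a. length a = n \<and> set a \<subseteq> int_box R \<and>
      (\<exists>p. prime p \<and> R < real p \<and> (\<forall>S\<in>subsets. \<not> vanishes p S []) \<and> (\<forall>S\<in>subsets. vanishes p S a))}"
  have X1: "finite (X1 p) \<and> real (card (X1 p)) \<le> K * (1 / real p ^ (n + 1 - s))" if "p \<in> P" for p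
    using card_solutions_small_prime_le[of p R] that s M by (auto simp: X1_def K_def P_def)
  have X2: "finite X2" "real (card X2) \<le> (real n + 1) * (2 * guide_size) ^ Suc n * (3 * R) ^ s"
    unfolding X2_def by (intro card_large_prime_solutions_le s \<open>R \<ge> 2\<close>)+
  have P: "finite P" "(\<Sum>p\<in>P. 1 / real p ^ (n + 1 - s)) \<le> 2 * (ln 4 + 1) / (M ^ (n - s) * ln M)"
    using sum_primes_inverse_power_le[where k = "n + 1 - s" and M = M and X = R] s M by (simp_all add: P_def)
  have "X \<subseteq> (\<Union>p\<in>P. X1 p) \<union> X2"
  proof
    fix a assume "a \<in> X"
    then obtain p where p: "prime p" "M < real p" and a: "a \<in> X1 p"
      by (auto simp: X_def X1_def)
    show "a \<in> (\<Union>p\<in>P. X1 p) \<union> X2"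
    proof (cases "real p \<le> R")
      case True
      then show ?thesis using p a by (auto simp: P_def)
    next
      case False
      have "\<forall>S\<in>subsets. \<not> vanishes p S []"
        using not_vanishes_Nil[of p] p(2) M(2) by auto
      with False p(1) a have "a \<in> X2" by (auto simp: X1_def X2_def)
      then show ?thesis by simp
    qed
  qed
  then have "card X \<le> card ((\<Union>p\<in>P. X1 p) \<union> X2)"
    using P X1 X2 by (intro card_mono) auto
  also have "\<dots> \<le> card (\<Union>p\<in>P. X1 p) + card X2" by (rule card_Un_le)
  also have "card (\<Union>p\<in>P. X1 p) \<le> (\<Sum>p\<in>P. card (X1 p))" by (rule card_UN_le[OF P(1)])
  finally have "real (card X) \<le> real ((\<Sum>p\<in>P. card (X1 p)) + card X2)"
    by (simp only: of_nat_le_iff)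
  also have "\<dots> = (\<Sum>p\<in>P. real (card (X1 p))) + real (card X2)" by simp
  also have "(\<Sum>p\<in>P. real (card (X1 p))) \<le> (\<Sum>p\<in>P. K * (1 / real p ^ (n + 1 - s)))"
    using X1 by (intro sum_mono) auto
  also have "\<dots> = K * (\<Sum>p\<in>P. 1 / real p ^ (n + 1 - s))"
    by (simp add: sum_distrib_left)
  also have "\<dots> \<le> K * (2 * (ln 4 + 1) / (M ^ (n - s) * ln M))"
    using P(2) \<open>R \<ge> 2\<close> by (intro mult_left_mono) (auto simp: K_def)
  finally have "real (card X) \<le> K * (2 * (ln 4 + 1) / (M ^ (n - s) * ln M)) + real (card X2)"
    by simp
  also have "\<dots> \<le> K * (2 * (ln 4 + 1) / (M ^ (n - s) * ln M)) +
      (real n + 1) * (2 * guide_size) ^ Suc n * (3 * R) ^ s"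
    using X2(2) by (rule add_left_mono)
  also have "K * (2 * (ln 4 + 1) / (M ^ (n - s) * ln M)) =
      (2 ^ n * (real D + 1) * 6) ^ n * (2 * (ln 4 + 1)) * (R ^ n / (M ^ (n - s) * ln M))"
    unfolding K_def times_divide_eq_right by (simp only: mult_ac)
  also have "(real n + 1) * (2 * guide_size) ^ Suc n * (3 * R) ^ s =
      (real n + 1) * (2 * guide_size) ^ Suc n * 3 ^ s * R ^ s"
    by (simp only: power_mult_distrib mult.assoc)
  finally show ?thesis .
qed

text \<open>For \<open>s = 0\<close> the only polynomial of the system is a nonzero constant.\<close>

lemma no_solutions_if_inconsistent:
  assumes "s = 0" "real p > real coeff_bound" "length a = n" "set a \<subseteq> int_box R"
  shows "\<not> (\<forall>S\<in>subsets. vanishes p S a)"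
proof
  assume "\<forall>S\<in>subsets. vanishes p S a"
  then have "card {j. j < n \<and> a ! j \<notin> determined p R (take j a)} < s"
    using not_vanishes_Nil[OF assms(2)] by (intro card_undetermined_less[OF assms(3,4)]) auto
  then show False using assms(1) by simp
qed

end


section \<open>From polynomials to elimination systems\<close>

text \<open>The coefficient at the exponent list \<open>e\<close>, where \<open>vs\<close> enumerates the variables. If \<open>e\<close> is not the
  exponent list of a monomial of \<open>f\<close>, for instance because of its length, the sum is empty.\<close>

definition list_coeff :: "'n list \<Rightarrow> ('n::finite) int_mpoly \<Rightarrow> nat list \<Rightarrow> int"
  where "list_coeff vs f e =
    (\<Sum>m\<in>{m \<in> Poly_Mapping.keys f. map (Poly_Mapping.lookup m) vs = e}. Poly_Mapping.lookup f m)"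

lemma list_coeff_nonzeroE:
  assumes "list_coeff vs f e \<noteq> 0"
  obtains m where "m \<in> Poly_Mapping.keys f" "e = map (Poly_Mapping.lookup m) vs"
proof -
  have "{m \<in> Poly_Mapping.keys f. map (Poly_Mapping.lookup m) vs = e} \<noteq> {}"
    using assms unfolding list_coeff_def by (metis sum.empty)
  then show thesis using that by blast
qed

lemma list_coeff_map_lookup:
  assumes "set vs = UNIV"
  shows "list_coeff vs f (map (Poly_Mapping.lookup m) vs) = Poly_Mapping.lookup f m"
proof -
  have "m' = m" if "map (Poly_Mapping.lookup m') vs = map (Poly_Mapping.lookup m) vs" for m'
    using that assms by (intro poly_mapping_eqI) auto
  then have "{m' \<in> Poly_Mapping.keys f. map (Poly_Mapping.lookup m') vs = map (Poly_Mapping.lookup m) vs}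
      = (if m \<in> Poly_Mapping.keys f then {m} else {})"
    by auto
  then show ?thesis
    by (simp add: list_coeff_def in_keys_iff)
qed

lemma monom_at_map:
  assumes "distinct vs" "set vs = UNIV"
  shows "monom_at (map (\<lambda>i. x $ i) vs) (map u vs) = (\<Prod>i\<in>UNIV. (x $ i) ^ u i)"
proof -
  have "monom_at (map (\<lambda>i. x $ i) vs) (map u vs) = prod_list (map (\<lambda>i. (x $ i) ^ u i) vs)"
    by (induction vs) simp_all
  also have "\<dots> = (\<Prod>i\<in>set vs. (x $ i) ^ u i)"
    using assms(1) by (simp add: prod.distinct_set_conv_list)
  finally show ?thesis by (simp add: assms(2))
qed

lemma sum_list_coeff:
  assumes "distinct vs" "set vs = UNIV" "degrees_le D f"
  shows "(\<Sum>e\<in>exponents D (length vs). list_coeff vs f e * monom_at (map (\<lambda>i. x $ i) vs) e)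
    = eval_int_mpoly f x"
proof -
  define h where "h m = Poly_Mapping.lookup f m * monom_at (map (\<lambda>i. x $ i) vs) (map (Poly_Mapping.lookup m) vs)" for m
  have "(\<Sum>e\<in>exponents D (length vs). list_coeff vs f e * monom_at (map (\<lambda>i. x $ i) vs) e)
      = (\<Sum>e\<in>exponents D (length vs). sum h {m \<in> Poly_Mapping.keys f. map (Poly_Mapping.lookup m) vs = e})"
    unfolding list_coeff_def sum_distrib_right by (intro sum.cong refl) (auto simp: h_def)
  also have "\<dots> = sum h (Poly_Mapping.keys f)"
    using assms(3) by (intro sum.group finite_exponents) (auto simp: exponents_def degrees_le_iff)
  also have "\<dots> = eval_int_mpoly f x"
    by (simp add: h_def eval_int_mpoly_def monom_at_map[OF assms(1,2)])
  finally show ?thesis .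
qed

lemma eval_reduce_mod_cong:
  "[eval_int_mpoly f (reduce_mod a p) = eval_int_mpoly f a] (mod int p)"
  unfolding eval_int_mpoly_def reduce_mod_def
  by (intro cong_sum cong_mult cong_prod cong_pow) (simp_all add: cong_def)

lemma Fp_points_imp_dvd:
  assumes "reduce_mod a p \<in> Fp_points Y p" "f \<in> Y"
  shows "int p dvd eval_int_mpoly f a"
proof -
  have "[eval_int_mpoly f (reduce_mod a p) = 0] (mod int p)"
    using assms by (simp add: Fp_points_def)
  then have "[eval_int_mpoly f a = 0] (mod int p)"
    by (rule cong_trans[OF cong_sym[OF eval_reduce_mod_cong]])
  then show ?thesis by (simp add: cong_0_iff)
qed

text \<open>The coordinates are read in the order of \<open>vs\<close>, and \<open>c S\<close> is an eliminant for the variables at the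
  positions in \<open>S\<close>.\<close>

lemma exists_elimination_system:
  fixes Y :: "('n::finite) int_mpoly set" and vs :: "'n list"
  assumes "ideal Y int_mpoly_ring" "codimension int_mpoly_ring Y = enat k" "k \<ge> 1"
    and vs: "distinct vs" "set vs = UNIV"
  shows "\<exists>D c. elimination_system CARD('n) (CARD('n) + 1 - k) D c \<and>
    (\<forall>a p. reduce_mod a p \<in> Fp_points Y p \<longrightarrow>
      (\<forall>S\<in>elimination_system.subsets CARD('n) (CARD('n) + 1 - k).
        elimination_system.vanishes D c p S (map (\<lambda>i. a $ i) vs)))"
proof -
  define n where "n = CARD('n)"
  define s where "s = n + 1 - k"
  have len: "length vs = n"
    using vs distinct_card[of vs] by (simp add: n_def)
  define SS where "SS = {S. S \<subseteq> {..<n} \<and> card S = s}"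
  have "\<exists>f. f \<in> Y \<and> f \<noteq> 0 \<and> (\<forall>m\<in>Poly_Mapping.keys f. Poly_Mapping.keys m \<subseteq> (!) vs ` S)"
    if "S \<in> SS" for S
  proof -
    have "inj_on ((!) vs) S"
      using that vs(1) len by (auto simp: SS_def intro!: inj_on_nth)
    then have "card ((!) vs ` S) = CARD('n) + 1 - k"
      using that by (simp add: SS_def card_image s_def n_def)
    from eliminant_exists[OF assms(1-3) this] show ?thesis by blast
  qed
  then obtain F where F: "\<And>S. S \<in> SS \<Longrightarrow> F S \<in> Y" "\<And>S. S \<in> SS \<Longrightarrow> F S \<noteq> 0"
    "\<And>S m. S \<in> SS \<Longrightarrow> m \<in> Poly_Mapping.keys (F S) \<Longrightarrow> Poly_Mapping.keys m \<subseteq> (!) vs ` S"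
    by metis
  have "finite SS" by (simp add: SS_def)
  then obtain fs where fs: "set fs = F ` SS"
    using finite_list finite_imageI by metis
  obtain D where D: "\<And>S. S \<in> SS \<Longrightarrow> degrees_le D (F S)"
    using degrees_le_exists_list[of fs] fs by auto
  define c where "c S = list_coeff vs (F S)" for S
  interpret elimination_system n s D c
  proof
    fix S assume "S \<subseteq> {..<n}" "card S = s"
    then have S: "S \<in> SS" by (simp add: SS_def)
    show "\<exists>e. c S e \<noteq> 0"
    proof -
      obtain m where "Poly_Mapping.lookup (F S) m \<noteq> 0"
        using F(2)[OF S] by (metis lookup_zero poly_mapping_eqI)
      then show ?thesis
        using list_coeff_map_lookup[OF vs(2), of "F S" m]
        by (intro exI[of _ "map (Poly_Mapping.lookup m) vs"]) (simp add: c_def)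
    qed
    fix e assume "c S e \<noteq> 0"
    then obtain m where m: "m \<in> Poly_Mapping.keys (F S)" "e = map (Poly_Mapping.lookup m) vs"
      unfolding c_def by (rule list_coeff_nonzeroE)
    have "e \<in> exponents D n"
      using D[OF S] m by (auto simp: exponents_def degrees_le_iff len)
    moreover have "e ! j = 0" if j: "j < n" "j \<notin> S" for j
    proof -
      have "vs ! j \<notin> (!) vs ` S"
        using j \<open>S \<subseteq> {..<n}\<close> vs(1) len by (auto simp: nth_eq_iff_index_eq subset_iff)
      then have "vs ! j \<notin> Poly_Mapping.keys m"
        using F(3)[OF S m(1)] by blast
      then show ?thesis using m(2) j len by (simp add: in_keys_iff)
    qed
    ultimately show "e \<in> exponents D n \<and> (\<forall>j<n. j \<notin> S \<longrightarrow> e ! j = 0)" by blast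
  qed
  have "vanishes p S (map (\<lambda>i. a $ i) vs)"
    if "reduce_mod a p \<in> Fp_points Y p" "S \<in> subsets" for a p S
    unfolding vanishes_def
  proof
    fix \<mu>
    have S: "S \<in> SS" using that(2) by (simp add: SS_def subsets_def)
    show "int p dvd foldl (subst_head D) (c S) (map (\<lambda>i. a $ i) vs) \<mu>"
    proof (cases "\<mu> = []")
      case True
      then show ?thesis
        using sum_list_coeff[OF vs D[OF S], of a] Fp_points_imp_dvd[OF that(1) F(1)[OF S]]
        by (simp add: foldl_subst_head c_def)
    next
      case False
      have "c S (e @ \<mu>) = 0" if "e \<in> exponents D (length vs)" for e
      proof (rule ccontr)
        assume "c S (e @ \<mu>) \<noteq> 0"
        then have "length (e @ \<mu>) = n"
          using support[of S "e @ \<mu>"] \<open>S \<in> subsets\<close> by (auto simp: subsets_def exponents_def)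
        with that False len show False by (simp add: exponents_def)
      qed
      then show ?thesis by (simp add: foldl_subst_head)
    qed
  qed
  then show ?thesis
    using elimination_system_axioms unfolding n_def s_def by blast
qed

section \<open>The bound for compact regions\<close>

lemma card_int_lists_le:
  assumes "R \<ge> 1"
  shows "finite {w. length w = n \<and> set w \<subseteq> int_box R}"
    "real (card {w. length w = n \<and> set w \<subseteq> int_box R}) \<le> (3 * R) ^ n"
proof -
  have eq: "{w. length w = n \<and> set w \<subseteq> int_box R} = {w. set w \<subseteq> int_box R \<and> length w = n}"
    by auto
  show "finite {w. length w = n \<and> set w \<subseteq> int_box R}"
    unfolding eq by (rule finite_lists_length_eq) simp
  have "real (card (int_box R)) \<le> 3 * R"
    using card_int_box[of R] assms by linarith
  then show "real (card {w. length w = n \<and> set w \<subseteq> int_box R}) \<le> (3 * R) ^ n"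
    unfolding eq card_lists_length_eq[OF finite_int_box] of_nat_power by (rule power_mono) simp
qed

text \<open>Near \<open>0\<close> the logarithm is controlled by \<open>\<bar>ln M\<bar> \<le> 1 / M\<close>, which is where \<open>k \<ge> 2\<close> is used.\<close>

lemma power_times_abs_ln_le:
  fixes M :: real
  assumes "0 < M" "M \<le> M0" "1 \<le> M0" "k \<ge> 2"
  shows "M ^ (k - 1) * \<bar>ln M\<bar> \<le> M0 ^ k"
proof (cases "M < 1")
  case True
  have "ln (1 / M) \<le> 1 / M - 1"
    using assms(1) by (intro ln_le_minus_one) auto
  then have "\<bar>ln M\<bar> \<le> 1 / M"
    using assms(1) True by (simp add: ln_div)
  moreover have "M ^ (k - 1) \<le> M ^ 1"
    using assms True by (intro power_decreasing) auto
  ultimately have "M ^ (k - 1) * \<bar>ln M\<bar> \<le> M * (1 / M)"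
    using assms(1) by (intro mult_mono) auto
  also have "\<dots> = 1" using assms(1) by simp
  also have "\<dots> \<le> M0 ^ k" using assms(3) by simp
  finally show ?thesis .
next
  case False
  then have "\<bar>ln M\<bar> \<le> M0"
    using ln_le_minus_one[of M] assms by auto
  then have "M ^ (k - 1) * \<bar>ln M\<bar> \<le> M0 ^ (k - 1) * M0"
    using assms by (intro mult_mono power_mono) auto
  also have "\<dots> = M0 ^ k"
    using assms(4) by (simp add: power_eq_if)
  finally show ?thesis .
qed

theorem theorem3p3:
  fixes B :: "(real ^ 'n) set" and Y :: "('n::finite) int_mpoly set" and k :: nat
  assumes "compact B" and "B \<in> lmeasurable"
    and "ideal Y int_mpoly_ring"
    and "codimension int_mpoly_ring Y = enat k" and "k \<ge> 1"
  shows "\<forall>\<delta>>0. \<exists>C. \<forall>(r::real) (M::real). r \<ge> \<delta> \<longrightarrow> M > 0 \<longrightarrow> M \<noteq> 1 \<longrightarrow>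
    real (card {a :: int ^ 'n. real_vec a \<in> (\<lambda>b. r *\<^sub>R b) ` B \<and>
        (\<exists>p::nat. prime p \<and> real p > M \<and> reduce_mod a p \<in> Fp_points Y p)})
    \<le> C * (r ^ CARD('n) / (M ^ (k - 1) * \<bar>ln M\<bar>) + r powi (int CARD('n) - int k + 1))"
proof (intro allI impI)
  fix \<delta> :: real assume "\<delta> > 0"
  define n where "n = CARD('n)"
  define s where "s = n + 1 - k"
  obtain vs :: "'n list" where vs: "distinct vs" "set vs = UNIV"
    using finite_distinct_list[of "UNIV :: 'n set"] by auto
  have len: "length vs = n"
    using vs distinct_card[of vs] by (simp add: n_def)
  define coords where "coords a = map (\<lambda>i. a $ i) vs" for a :: "int ^ 'n"
  have inj: "inj coords"
    using vs(2) by (auto simp: inj_def coords_def vec_eq_iff)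
  obtain D c where "elimination_system n s D c"
    and vanish: "\<And>a p S. reduce_mod a p \<in> Fp_points Y p \<Longrightarrow>
      S \<in> elimination_system.subsets n s \<Longrightarrow> elimination_system.vanishes D c p S (coords a)"
    using exists_elimination_system[OF assms(3-5) vs] unfolding n_def s_def coords_def by blast
  then interpret elimination_system n s D c by simp
  obtain b0 where b0: "\<And>x. x \<in> B \<Longrightarrow> norm x \<le> b0"
    using compact_imp_bounded[OF assms(1)] by (auto simp: bounded_iff)
  \<comment> \<open>Large enough that the box of radius \<open>R = r * b\<close> contains the dilated region
    and that \<open>R \<ge> 2\<close> whenever \<open>r \<ge> \<delta>\<close>.\<close>
  define b where "b = max b0 (2 / \<delta>)"
  have b: "b > 0" "b0 \<le> b" "2 / \<delta> \<le> b"
    using \<open>\<delta> > 0\<close> by (auto simp: b_def less_max_iff_disj)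
  \<comment> \<open>Modulo a prime above \<open>coeff_bound\<close> none of the eliminants is zero.\<close>
  define M0 where "M0 = real coeff_bound + 2"
  define C0 where "C0 = (3 * b) ^ n * M0 ^ k"
  define L1 where "L1 = (2 ^ n * (real D + 1) * 6) ^ n * (2 * (ln 4 + 1))"
  define L2 where "L2 = (real n + 1) * (2 * guide_size) ^ Suc n * 3 ^ s"
  define C1 where "C1 = L1 * b ^ n"
  define C2 where "C2 = L2 * b ^ s"
  have nonneg: "C0 \<ge> 0" "C1 \<ge> 0" "C2 \<ge> 0"
    using b guide_size_ge(2) by (auto simp: C0_def C1_def C2_def L1_def L2_def M0_def intro!: mult_nonneg_nonneg)
  show "\<exists>C. \<forall>(r::real) (M::real). r \<ge> \<delta> \<longrightarrow> M > 0 \<longrightarrow> M \<noteq> 1 \<longrightarrow>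
    real (card {a :: int ^ 'n. real_vec a \<in> (\<lambda>b. r *\<^sub>R b) ` B \<and>
        (\<exists>p::nat. prime p \<and> real p > M \<and> reduce_mod a p \<in> Fp_points Y p)})
    \<le> C * (r ^ CARD('n) / (M ^ (k - 1) * \<bar>ln M\<bar>) + r powi (int CARD('n) - int k + 1))"
  proof (intro exI[of _ "C0 + C1 + C2"] allI impI)
    fix r M :: real assume r: "r \<ge> \<delta>" and M: "M > 0" "M \<noteq> 1"
    define A where "A = {a :: int ^ 'n. real_vec a \<in> (\<lambda>b. r *\<^sub>R b) ` B \<and>
        (\<exists>p::nat. prime p \<and> real p > M \<and> reduce_mod a p \<in> Fp_points Y p)}"
    define E1 where "E1 = r ^ n / (M ^ (k - 1) * \<bar>ln M\<bar>)"
    define E2 where "E2 = r powi (int n - int k + 1)"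
    define R where "R = r * b"
    have r0: "r > 0" using r \<open>\<delta> > 0\<close> by linarith
    have "E1 \<ge> 0" "E2 \<ge> 0" using r0 M by (auto simp: E1_def E2_def)
    have R: "R \<ge> 2"
    proof -
      have "2 = \<delta> * (2 / \<delta>)" using \<open>\<delta> > 0\<close> by simp
      also have "\<dots> \<le> r * b" using r b \<open>\<delta> > 0\<close> by (intro mult_mono) auto
      finally show ?thesis by (simp add: R_def)
    qed
    define X where "X = {w. length w = n \<and> set w \<subseteq> int_box R \<and>
      (\<exists>p. prime p \<and> M < real p \<and> (\<forall>S\<in>subsets. vanishes p S w))}"
    define W where "W = {w. length w = n \<and> set w \<subseteq> int_box R}"
    have W: "finite W" "real (card W) \<le> (3 * R) ^ n"
      using card_int_lists_le[of R n] R by (simp_all add: W_def)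
    have "coords ` A \<subseteq> X"
    proof clarify
      fix a assume "a \<in> A"
      then obtain x p where a: "real_vec a = r *\<^sub>R x" "x \<in> B"
        and p: "prime p" "real p > M" "reduce_mod a p \<in> Fp_points Y p"
        by (auto simp: A_def)
      have "a $ i \<in> int_box R" for i
      proof -
        have "\<bar>real_of_int (a $ i)\<bar> \<le> norm (real_vec a)"
          using component_le_norm_cart[of "real_vec a" i] by (simp add: real_vec_def)
        also have "\<dots> = r * norm x" using a(1) r0 by simp
        also have "\<dots> \<le> r * b" using b0[OF a(2)] b r0 by (intro mult_left_mono) auto
        finally show ?thesis by (simp add: int_box_def R_def)
      qed
      then show "coords a \<in> X"
        using p vanish[OF p(3)] len by (auto simp: X_def coords_def)
    qed
    moreover have "X \<subseteq> W" by (auto simp: X_def W_def)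
    ultimately have cards: "card A \<le> card X" "card X \<le> card W"
      using card_mono[of X "coords ` A"] card_mono[of W X] finite_subset[of X W] W(1)
        card_image[OF inj_on_subset[OF inj subset_UNIV], of A] by auto
    have trivial: "real (card A) \<le> (3 * b) ^ n * r ^ n"
      using cards W(2) by (simp add: R_def power_mult_distrib mult_ac)
    have "real (card A) \<le> (C0 + C1 + C2) * (E1 + E2)"
    proof (cases "k = 1")
      case True
      have "(3 * b) ^ n * r ^ n \<le> C0 * E2"
        using True b r0 by (auto simp: C0_def E2_def M0_def intro!: mult_right_mono)
      also have "\<dots> \<le> (C0 + C1 + C2) * (E1 + E2)"
        using nonneg \<open>E1 \<ge> 0\<close> \<open>E2 \<ge> 0\<close> by (intro mult_mono) auto
      finally show ?thesis using trivial by linarith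
    next
      case False
      then have k: "k \<ge> 2" using assms(5) by simp
      show ?thesis
      proof (cases "M \<le> M0")
        case True
        have "0 < M ^ (k - 1) * \<bar>ln M\<bar>" using M by simp
        moreover have "M ^ (k - 1) * \<bar>ln M\<bar> \<le> M0 ^ k"
          using M True k by (intro power_times_abs_ln_le) (auto simp: M0_def)
        ultimately have "r ^ n * (M ^ (k - 1) * \<bar>ln M\<bar>) \<le> r ^ n * M0 ^ k"
          using r0 by (intro mult_left_mono) auto
        with \<open>0 < M ^ (k - 1) * \<bar>ln M\<bar>\<close> have "r ^ n \<le> M0 ^ k * E1"
          by (simp add: E1_def pos_le_divide_eq mult_ac)
        then have "(3 * b) ^ n * r ^ n \<le> (3 * b) ^ n * (M0 ^ k * E1)"
          using b by (intro mult_left_mono) auto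
        also have "\<dots> = C0 * E1" by (simp add: C0_def)
        also have "\<dots> \<le> (C0 + C1 + C2) * (E1 + E2)"
          using nonneg \<open>E1 \<ge> 0\<close> \<open>E2 \<ge> 0\<close> by (intro mult_mono) auto
        finally show ?thesis using trivial by linarith
      next
        case False
        then have M1: "M > 1" "M \<ge> real coeff_bound" by (auto simp: M0_def)
        show ?thesis
        proof (cases "s = 0")
          case True
          then have "X = {}"
            using no_solutions_if_inconsistent[of _ _ R] M1 by (force simp: X_def)
          then show ?thesis
            using cards nonneg \<open>E1 \<ge> 0\<close> \<open>E2 \<ge> 0\<close> by simp
        next
          case False
          then have s: "1 \<le> s" "s < n" "n - s = k - 1" "int n - int k + 1 = int s"
            using k by (auto simp: s_def)
          have "real (card X) \<le> L1 * (R ^ n / (M ^ (n - s) * ln M)) + L2 * R ^ s"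
            unfolding X_def L1_def L2_def by (rule card_solutions_le[OF s(1,2) R M1])
          also have "\<dots> = C1 * E1 + C2 * E2"
            using M1 by (simp add: C1_def C2_def E1_def E2_def R_def s(3,4) power_mult_distrib mult_ac)
          also have "\<dots> \<le> (C0 + C1 + C2) * E1 + (C0 + C1 + C2) * E2"
            using nonneg \<open>E1 \<ge> 0\<close> \<open>E2 \<ge> 0\<close> by (intro add_mono mult_right_mono) auto
          finally show ?thesis using cards by (simp add: distrib_left)
        qed
      qed
    qed
    then show "real (card {a :: int ^ 'n. real_vec a \<in> (\<lambda>b. r *\<^sub>R b) ` B \<and>
        (\<exists>p::nat. prime p \<and> real p > M \<and> reduce_mod a p \<in> Fp_points Y p)})
      \<le> (C0 + C1 + C2) * (r ^ CARD('n) / (M ^ (k - 1) * \<bar>ln M\<bar>) + r powi (int CARD('n) - int k + 1))"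
      by (simp add: A_def E1_def E2_def n_def)
  qed
qed

end
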